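(* Let $q\in\mathbb{C}^*$ be generic, and consider the chain of subalgebras $\mathcal{A}_q(2)\subset\mathcal{L}_q(2)\subset\mathscr{D}_q$. For any pair $(a,b)$ of co-prime positive integers and any $\lambda\in\mathbb{C}^*$, let $Q=y^b-\lambda x^{-a}$ and let $\mathcal{J}_Q=\mathscr{D}_qQ$ be the left ideal of $\mathscr{D}_q$ generated by $Q$. Denote $\widehat{L}_Q=\mathscr{D}_q/\mathcal{J}_Q$ and $L_Q=\mathcal{L}_q(2)/(\mathcal{L}_q(2)\cap\mathcal{J}_Q)$. Then (i) $\widehat{L}_Q$ is a simple $\mathscr{D}_q$-module; (ii) $L_Q$ is a simple $\mathcal{L}_q(2)$-module; and (iii) the restriction $L_Q|_{\mathcal{A}_q(2)}$ is isomorphic to the simple $\mathcal{A}_q(2)$-module $L_{(a,b)}[\lambda]$.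
   Context: Generic means that $q$ is not a root of unity. $\mathcal{L}_q(2)$ is the associative unital $\mathbb{C}$-algebra generated by $x^{\pm1},y^{\pm1}$ with relation $xy=q\,yx$, and $\mathcal{A}_q(2)$ is its subalgebra generated by $x,y$. $\mathbb{C}((x))$ is the field of formal Laurent series. The algebra $\mathscr{D}_q$ of $q$-difference operators has underlying vector space $\mathbb{C}((x))[y,y^{-1}]$ with multiplication determined by $y\,f(x)=f(q^{-1}x)\,y$ for all $f(x)\in\mathbb{C}((x))$ (in particular $xy=q\,yx$). Modules are left modules. For co-prime positive integers $(a,b)$ and $[\lambda]\in\mathbb{C}^*/q^{\mathbb{Z}}$ (where $q^{\mathbb{Z}}=\{q^m\mid m\in\mathbb{Z}\}$), $L_{(a,b)}[\lambda]$ denotes the simple $\mathcal{A}_q(2)$-module cyclically generated by an eigenvector of $K=x^ay^b$ with eigenvalue $\lambda$ (it exists, is unique up to isomorphism, and depends only on the class $[\lambda]$). *)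

theory Defs
  imports
    Complex_Main
    "HOL-Library.Poly_Mapping"
    "HOL-Computational_Algebra.Formal_Laurent_Series"
    "HOL-Algebra.Module"
    "HOL-Algebra.QuotRing"
    "HOL-Algebra.Generated_Rings"
begin

section \<open>The algebra of q-difference operators\<close>

text \<open>The substitution \<open>f(x) \<mapsto> f(c x)\<close> on Laurent series.\<close>

lift_definition fls_dilate :: "complex \<Rightarrow> complex fls \<Rightarrow> complex fls"
  is "\<lambda>c f n. c powi n * f n"
  by (auto elim: eventually_mono)

text \<open>
  An operator is a finitely supported family of Laurent series: \<open>P\<close> stands for
  the sum of the terms \<open>lookup P i\<close> times \<open>y\<^sup>i\<close>, with the coefficients written on
  the left. Since \<open>y\<^sup>i g(x) = g(q\<^sup>-\<^sup>i x) y\<^sup>i\<close>, the product of \<open>f y\<^sup>i\<close> and \<open>g y\<^sup>j\<close> is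
  \<open>f(x) g(q\<^sup>-\<^sup>i x) y\<^sup>i\<^sup>+\<^sup>j\<close>.
\<close>

type_synonym qop = "int \<Rightarrow>\<^sub>0 complex fls"

definition qop_mult :: "complex \<Rightarrow> qop \<Rightarrow> qop \<Rightarrow> qop" where
  "qop_mult q P R =
     (\<Sum>i\<in>Poly_Mapping.keys P. \<Sum>j\<in>Poly_Mapping.keys R.
        Poly_Mapping.single (i + j)
          (Poly_Mapping.lookup P i * fls_dilate (q powi (- i)) (Poly_Mapping.lookup R j)))"

definition Dq :: "complex \<Rightarrow> qop ring" where
  "Dq q = \<lparr>carrier = UNIV, mult = qop_mult q, one = Poly_Mapping.single 0 1,
           zero = 0, add = (+)\<rparr>"

abbreviation coeff_op :: "complex fls \<Rightarrow> qop" where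
  "coeff_op f \<equiv> Poly_Mapping.single 0 f"

abbreviation scalar_op :: "complex \<Rightarrow> qop" where
  "scalar_op c \<equiv> coeff_op (fls_const c)"

definition x_op :: qop where "x_op = coeff_op fls_X"
definition x_inv_op :: qop where "x_inv_op = coeff_op fls_X_inv"
definition y_op :: qop where "y_op = Poly_Mapping.single 1 1"
definition y_inv_op :: qop where "y_inv_op = Poly_Mapping.single (- 1) 1"

text \<open>
  The unital complex subalgebra generated by a set: the subring generated by
  that set together with the scalars.
\<close>

definition gen_subalgebra :: "complex \<Rightarrow> qop set \<Rightarrow> qop ring" where
  "gen_subalgebra q S =
     (Dq q)\<lparr>carrier := generate_ring (Dq q) (range scalar_op \<union> S)\<rparr>"

definition Lq :: "complex \<Rightarrow> qop ring" where
  "Lq q = gen_subalgebra q {x_op, x_inv_op, y_op, y_inv_op}"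

definition Aq :: "complex \<Rightarrow> qop ring" where
  "Aq q = gen_subalgebra q {x_op, y_op}"


section \<open>Left modules over a not necessarily commutative ring\<close>

text \<open>
  The axioms are those of the locale \<^locale>\<open>module\<close>, which requires the ring to be
  commutative. As there, the fields \<open>mult\<close> and \<open>one\<close> of the module record are
  irrelevant. Restricting a module to a subring leaves the record unchanged;
  only the ring argument of the predicates below changes.
\<close>

locale left_module = R?: ring R + M?: abelian_group M
  for R :: "('a, 'r) ring_scheme" (structure) and M :: "('a, 'b, 'm) module_scheme" (structure) +
  assumes lsmult_closed:
      "\<lbrakk>a \<in> carrier R; x \<in> carrier M\<rbrakk> \<Longrightarrow> a \<odot>\<^bsub>M\<^esub> x \<in> carrier M"
    and lsmult_l_distr:
      "\<lbrakk>a \<in> carrier R; b \<in> carrier R; x \<in> carrier M\<rbrakk> \<Longrightarrow>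
       (a \<oplus>\<^bsub>R\<^esub> b) \<odot>\<^bsub>M\<^esub> x = a \<odot>\<^bsub>M\<^esub> x \<oplus>\<^bsub>M\<^esub> b \<odot>\<^bsub>M\<^esub> x"
    and lsmult_r_distr:
      "\<lbrakk>a \<in> carrier R; x \<in> carrier M; y \<in> carrier M\<rbrakk> \<Longrightarrow>
       a \<odot>\<^bsub>M\<^esub> (x \<oplus>\<^bsub>M\<^esub> y) = a \<odot>\<^bsub>M\<^esub> x \<oplus>\<^bsub>M\<^esub> a \<odot>\<^bsub>M\<^esub> y"
    and lsmult_assoc:
      "\<lbrakk>a \<in> carrier R; b \<in> carrier R; x \<in> carrier M\<rbrakk> \<Longrightarrow>
       (a \<otimes>\<^bsub>R\<^esub> b) \<odot>\<^bsub>M\<^esub> x = a \<odot>\<^bsub>M\<^esub> (b \<odot>\<^bsub>M\<^esub> x)"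
    and lsmult_one:
      "x \<in> carrier M \<Longrightarrow> \<one>\<^bsub>R\<^esub> \<odot>\<^bsub>M\<^esub> x = x"

definition simple_left_module ::
  "('a, 'r) ring_scheme \<Rightarrow> ('a, 'b, 'm) module_scheme \<Rightarrow> bool" where
  "simple_left_module R M \<longleftrightarrow>
     left_module R M \<and> carrier M \<noteq> {\<zero>\<^bsub>M\<^esub>} \<and>
     (\<forall>N. submodule N R M \<longrightarrow> N = {\<zero>\<^bsub>M\<^esub>} \<or> N = carrier M)"

definition left_module_isomorphic ::
  "('a, 'r) ring_scheme \<Rightarrow> ('a, 'b, 'm) module_scheme \<Rightarrow> ('a, 'c, 'n) module_scheme \<Rightarrow> bool"
  where
  "left_module_isomorphic R M N \<longleftrightarrow>
     (\<exists>h. bij_betw h (carrier M) (carrier N) \<and>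
          (\<forall>u\<in>carrier M. \<forall>v\<in>carrier M. h (u \<oplus>\<^bsub>M\<^esub> v) = h u \<oplus>\<^bsub>N\<^esub> h v) \<and>
          (\<forall>r\<in>carrier R. \<forall>u\<in>carrier M. h (r \<odot>\<^bsub>M\<^esub> u) = r \<odot>\<^bsub>N\<^esub> h u))"

text \<open>The quotient of the regular left module by a left ideal \<open>J\<close>, with \<open>r (J + s) = J + r s\<close>.\<close>

definition quotient_module :: "('a, 'r) ring_scheme \<Rightarrow> 'a set \<Rightarrow> ('a, 'a set) module" where
  "quotient_module R J =
     \<lparr>carrier = a_rcosets\<^bsub>R\<^esub> J, mult = undefined, one = undefined,
      zero = J, add = set_add R,
      smult = (\<lambda>r C. \<Union>s\<in>C. J +>\<^bsub>R\<^esub> (r \<otimes>\<^bsub>R\<^esub> s))\<rparr>"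


section \<open>The modules attached to Q and K\<close>

definition Q_op :: "complex \<Rightarrow> nat \<Rightarrow> nat \<Rightarrow> complex \<Rightarrow> qop" where
  "Q_op q a b lam =
     (y_op [^]\<^bsub>Dq q\<^esub> b) \<ominus>\<^bsub>Dq q\<^esub> (scalar_op lam \<otimes>\<^bsub>Dq q\<^esub> (x_inv_op [^]\<^bsub>Dq q\<^esub> a))"

definition J_Q :: "complex \<Rightarrow> nat \<Rightarrow> nat \<Rightarrow> complex \<Rightarrow> qop set" where
  "J_Q q a b lam = {P \<otimes>\<^bsub>Dq q\<^esub> Q_op q a b lam |P. P \<in> carrier (Dq q)}"

definition Lhat_Q :: "complex \<Rightarrow> nat \<Rightarrow> nat \<Rightarrow> complex \<Rightarrow> (qop, qop set) module" where
  "Lhat_Q q a b lam = quotient_module (Dq q) (J_Q q a b lam)"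

definition L_Q :: "complex \<Rightarrow> nat \<Rightarrow> nat \<Rightarrow> complex \<Rightarrow> (qop, qop set) module" where
  "L_Q q a b lam = quotient_module (Lq q) (carrier (Lq q) \<inter> J_Q q a b lam)"

definition K_op :: "complex \<Rightarrow> nat \<Rightarrow> nat \<Rightarrow> qop" where
  "K_op q a b = (x_op [^]\<^bsub>Aq q\<^esub> a) \<otimes>\<^bsub>Aq q\<^esub> (y_op [^]\<^bsub>Aq q\<^esub> b)"

text \<open>
  The modules \<open>L\<^bsub>(a,b)\<^esub>[lam]\<close> are given up to isomorphism by the following property:
  simple, and cyclically generated by an eigenvector of \<open>K\<close> with eigenvalue \<open>lam\<close>.
\<close>

definition is_L_ab ::
  "complex \<Rightarrow> nat \<Rightarrow> nat \<Rightarrow> complex \<Rightarrow> (qop, 'b, 'm) module_scheme \<Rightarrow> bool" where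
  "is_L_ab q a b lam M \<longleftrightarrow>
     simple_left_module (Aq q) M \<and>
     (\<exists>v\<in>carrier M. v \<noteq> \<zero>\<^bsub>M\<^esub> \<and> K_op q a b \<odot>\<^bsub>M\<^esub> v = scalar_op lam \<odot>\<^bsub>M\<^esub> v \<and>
        carrier M = {r \<odot>\<^bsub>M\<^esub> v |r. r \<in> carrier (Aq q)})"

text \<open>The class of \<open>lam\<close> in \<open>\<complex>\<^sup>*/q\<^sup>\<int>\<close>, as a set of scalars.\<close>

definition qclass :: "complex \<Rightarrow> complex \<Rightarrow> complex set" where
  "qclass q lam = range (\<lambda>m::int. q powi m * lam)"


section \<open>Basic facts\<close>

lemma fls_nth_dilate [simp]: "fls_nth (fls_dilate c f) n = c powi n * fls_nth f n"
  by transfer simp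

lemma fls_dilate_0 [simp]: "fls_dilate c 0 = 0"
  by (rule fls_eqI) simp

lemma fls_dilate_add: "fls_dilate c (f + g) = fls_dilate c f + fls_dilate c g"
  by (rule fls_eqI) (simp add: algebra_simps)

lemma fls_dilate_const [simp]: "fls_dilate c (fls_const d) = fls_const d"
  by (rule fls_eqI) simp

lemma fls_dilate_1_right [simp]: "fls_dilate c 1 = 1"
  by (rule fls_eqI) simp

lemma fls_dilate_1_left [simp]: "fls_dilate 1 f = f"
  by (rule fls_eqI) simp

lemma fls_dilate_dilate: "fls_dilate c (fls_dilate d f) = fls_dilate (c * d) f"
  by (rule fls_eqI) (simp add: power_int_mult_distrib mult.assoc)

lemma fls_dilate_mult:
  assumes "c \<noteq> 0"
  shows "fls_dilate c (f * g) = fls_dilate c f * fls_dilate c g"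
proof (cases "f = 0 \<or> g = 0")
  case False
  have sd: "fls_subdegree (fls_dilate c h) = fls_subdegree h" for h
  proof (cases "h = 0")
    case False
    then show ?thesis using assms
      by (intro fls_subdegree_eqI) (auto simp: fls_eq0_below_subdegree)
  qed simp
  show ?thesis
  proof (rule fls_eqI)
    fix n
    show "fls_nth (fls_dilate c (f * g)) n = fls_nth (fls_dilate c f * fls_dilate c g) n"
      using assms
      by (auto simp: fls_times_nth(2) sd sum_distrib_left power_int_diff field_simps
          intro!: sum.cong)
  qed
qed auto

lemma fls_dilate_X: "fls_dilate c fls_X = fls_const c * fls_X"
  by (rule fls_eqI) (auto simp: fls_X_times_conv_shift)

lemma qop_mult_superset:
  assumes "finite I" "Poly_Mapping.keys P \<subseteq> I" "finite J" "Poly_Mapping.keys R \<subseteq> J"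
  shows "qop_mult q P R =
     (\<Sum>i\<in>I. \<Sum>j\<in>J. Poly_Mapping.single (i + j)
        (Poly_Mapping.lookup P i * fls_dilate (q powi (- i)) (Poly_Mapping.lookup R j)))"
proof -
  let ?t = "\<lambda>i j. Poly_Mapping.single (i + j)
        (Poly_Mapping.lookup P i * fls_dilate (q powi (- i)) (Poly_Mapping.lookup R j))"
  have "(\<Sum>j\<in>J. ?t i j) = (\<Sum>j\<in>Poly_Mapping.keys R. ?t i j)" for i
    by (rule sum.mono_neutral_right) (use assms in \<open>auto simp: in_keys_iff\<close>)
  moreover have "(\<Sum>i\<in>I. \<Sum>j\<in>Poly_Mapping.keys R. ?t i j) = (\<Sum>i\<in>Poly_Mapping.keys P. \<Sum>j\<in>Poly_Mapping.keys R. ?t i j)"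
    by (rule sum.mono_neutral_right) (use assms in \<open>auto simp: in_keys_iff\<close>)
  ultimately show ?thesis by (simp add: qop_mult_def)
qed

lemma qop_mult_single:
  "qop_mult q (Poly_Mapping.single i f) (Poly_Mapping.single j g) =
     Poly_Mapping.single (i + j) (f * fls_dilate (q powi (- i)) g)"
  by (subst qop_mult_superset[of "{i}" _ "{j}"]) auto

lemma qop_mult_add_left: "qop_mult q (P + P') R = qop_mult q P R + qop_mult q P' R"
proof -
  let ?I = "Poly_Mapping.keys P \<union> Poly_Mapping.keys P' \<union> Poly_Mapping.keys (P + P')"
  have "qop_mult q S R = (\<Sum>i\<in>?I. \<Sum>j\<in>Poly_Mapping.keys R. Poly_Mapping.single (i + j)
        (Poly_Mapping.lookup S i * fls_dilate (q powi (- i)) (Poly_Mapping.lookup R j)))"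
    if "S \<in> {P, P', P + P'}" for S
    by (rule qop_mult_superset) (use that in auto)
  then show ?thesis
    by (simp add: lookup_add distrib_right single_add sum.distrib)
qed

lemma qop_mult_add_right: "qop_mult q P (R + R') = qop_mult q P R + qop_mult q P R'"
proof -
  let ?J = "Poly_Mapping.keys R \<union> Poly_Mapping.keys R' \<union> Poly_Mapping.keys (R + R')"
  have "qop_mult q P S = (\<Sum>i\<in>Poly_Mapping.keys P. \<Sum>j\<in>?J. Poly_Mapping.single (i + j)
        (Poly_Mapping.lookup P i * fls_dilate (q powi (- i)) (Poly_Mapping.lookup S j)))"
    if "S \<in> {R, R', R + R'}" for S
    by (rule qop_mult_superset) (use that in auto)
  then show ?thesis
    by (simp add: lookup_add distrib_left fls_dilate_add single_add sum.distrib)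
qed

lemma qop_mult_0 [simp]: "qop_mult q 0 R = 0" "qop_mult q P 0 = 0"
  by (simp_all add: qop_mult_def)

lemma qop_induct [case_names zero single add]:
  assumes "\<P> 0" "\<And>i f. \<P> (Poly_Mapping.single i f)"
    "\<And>P R. \<P> P \<Longrightarrow> \<P> R \<Longrightarrow> \<P> (P + R)"
  shows "\<P> (P :: qop)"
proof -
  have "P = (\<Sum>i\<in>Poly_Mapping.keys P. Poly_Mapping.single i (Poly_Mapping.lookup P i))"
    by (rule poly_mapping_eqI) (simp add: lookup_sum lookup_single when_def in_keys_iff)
  moreover have "\<P> (\<Sum>i\<in>I. Poly_Mapping.single i (Poly_Mapping.lookup P i))" if "finite I" for I
    using that by (induction I) (use assms in auto)
  ultimately show ?thesis by (metis finite_keys)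
qed

lemma qop_mult_assoc:
  assumes "q \<noteq> 0"
  shows "qop_mult q (qop_mult q P R) S = qop_mult q P (qop_mult q R S)"
proof (induction P rule: qop_induct)
  case (single i f)
  show ?case
  proof (induction R rule: qop_induct)
    case (single j g)
    show ?case
    proof (induction S rule: qop_induct)
      case (single k h)
      show ?case using assms
        by (simp add: qop_mult_single fls_dilate_mult fls_dilate_dilate power_int_add
            power_int_diff power_int_minus field_simps)
    qed (simp_all add: qop_mult_add_right)
  qed (simp_all add: qop_mult_add_right qop_mult_add_left)
qed (simp_all add: qop_mult_add_left)

lemma qop_mult_one: "qop_mult q (Poly_Mapping.single 0 1) P = P"
  "qop_mult q P (Poly_Mapping.single 0 1) = P"
  by (induction P rule: qop_induct)
    (simp_all add: qop_mult_add_right qop_mult_add_left qop_mult_single del: single_one)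

lemma ring_Dq:
  assumes "q \<noteq> 0"
  shows "ring (Dq q)"
proof (rule ringI)
  show "abelian_group (Dq q)"
    by (rule abelian_groupI)
      (auto simp: Dq_def algebra_simps intro: exI[of _ "- x" for x] left_minus)
  show "monoid (Dq q)"
    by (rule monoidI) (simp_all add: Dq_def qop_mult_one[simplified] qop_mult_assoc[OF assms])
qed (simp_all add: Dq_def qop_mult_add_left qop_mult_add_right)

lemma Dq_commutation:
  "y_op \<otimes>\<^bsub>Dq q\<^esub> coeff_op f = coeff_op (fls_dilate (inverse q) f) \<otimes>\<^bsub>Dq q\<^esub> y_op"
  by (simp add: Dq_def y_op_def qop_mult_single power_int_minus)

lemma Dq_xy:
  assumes "q \<noteq> 0"
  shows "x_op \<otimes>\<^bsub>Dq q\<^esub> y_op = scalar_op q \<otimes>\<^bsub>Dq q\<^esub> (y_op \<otimes>\<^bsub>Dq q\<^esub> x_op)"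
  using assms
  by (simp add: Dq_def x_op_def y_op_def qop_mult_single power_int_minus fls_dilate_X
      fls_const_mult_const flip: mult.assoc)

lemma Dq_inverses:
  "x_op \<otimes>\<^bsub>Dq q\<^esub> x_inv_op = \<one>\<^bsub>Dq q\<^esub>" "x_inv_op \<otimes>\<^bsub>Dq q\<^esub> x_op = \<one>\<^bsub>Dq q\<^esub>"
  "y_op \<otimes>\<^bsub>Dq q\<^esub> y_inv_op = \<one>\<^bsub>Dq q\<^esub>" "y_inv_op \<otimes>\<^bsub>Dq q\<^esub> y_op = \<one>\<^bsub>Dq q\<^esub>"
  by (simp_all add: Dq_def x_op_def x_inv_op_def y_op_def y_inv_op_def qop_mult_single
      fls_X_times_conv_shift fls_X_inv_times_conv_shift)

lemma subring_gen_subalgebra: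
  assumes "q \<noteq> 0"
  shows "subring (carrier (gen_subalgebra q S)) (Dq q)"
proof -
  interpret ring "Dq q" by (rule ring_Dq[OF assms])
  show ?thesis
    by (simp add: gen_subalgebra_def, rule generate_ring_is_subring) (simp add: Dq_def)
qed

lemma Aq_subset_Lq: "carrier (Aq q) \<subseteq> carrier (Lq q)"
proof
  fix P assume "P \<in> carrier (Aq q)"
  then have "P \<in> generate_ring (Dq q) (range scalar_op \<union> {x_op, y_op})"
    by (simp add: Aq_def gen_subalgebra_def)
  then have "P \<in> generate_ring (Dq q) (range scalar_op \<union> {x_op, x_inv_op, y_op, y_inv_op})"
    by induction (auto intro: generate_ring.intros)
  then show "P \<in> carrier (Lq q)" by (simp add: Lq_def gen_subalgebra_def)
qed

text \<open>
  The generated subalgebra consists of all complex linear combinations of the monomials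
  \<open>x\<^sup>i y\<^sup>j\<close> with integers \<open>i\<close>, \<open>j\<close>. These are linearly independent in the algebra of
  q-difference operators, and the relation \<open>x y = q y x\<close> already makes them span the
  abstractly presented algebra, which is therefore identified with this subalgebra.
\<close>

lemma Lq_carrier:
  assumes "q \<noteq> 0"
  shows "carrier (Lq q) = {P. \<forall>j. finite {i. fls_nth (Poly_Mapping.lookup P j) i \<noteq> 0}}"
    (is "_ = ?S")
proof
  let ?G = "generate_ring (Dq q) (range scalar_op \<union> {x_op, x_inv_op, y_op, y_inv_op})"
  let ?fs = "\<lambda>f :: complex fls. finite {i. fls_nth f i \<noteq> 0}"
  have G: "carrier (Lq q) = ?G" by (simp add: Lq_def gen_subalgebra_def)
  interpret D: ring "Dq q" by (rule ring_Dq[OF assms])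
  have neg: "\<ominus>\<^bsub>Dq q\<^esub> P = - P" for P
    by (rule D.minus_equality) (simp_all add: Dq_def)
  have fs_add: "?fs (f + g)" if "?fs f" "?fs g" for f g
    by (rule finite_subset[OF _ finite_UnI[OF that]]) auto
  have fs_mult: "?fs (f * g)" if "?fs f" "?fs g" for f g
  proof (rule finite_subset)
    show "finite ((\<lambda>(i, k). i + k) ` ({i. fls_nth f i \<noteq> 0} \<times> {i. fls_nth g i \<noteq> 0}))"
      using that by simp
    show "{n. fls_nth (f * g) n \<noteq> 0} \<subseteq>
        (\<lambda>(i, k). i + k) ` ({i. fls_nth f i \<noteq> 0} \<times> {i. fls_nth g i \<noteq> 0})"
    proof
      fix n assume "n \<in> {n. fls_nth (f * g) n \<noteq> 0}"
      then obtain i where "fls_nth f i * fls_nth g (n - i) \<noteq> 0"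
        unfolding mem_Collect_eq fls_times_nth(2) by (meson sum.neutral)
      then show "n \<in> (\<lambda>(i, k). i + k) ` ({i. fls_nth f i \<noteq> 0} \<times> {i. fls_nth g i \<noteq> 0})"
        by (auto intro!: image_eqI[of _ _ "(i, n - i)"])
    qed
  qed
  have fs_dilate: "?fs (fls_dilate c f)" if "?fs f" for c f
    by (rule finite_subset[OF _ that]) auto
  have S_add: "P + R \<in> ?S" if "P \<in> ?S" "R \<in> ?S" for P R
    using that fs_add by (simp add: lookup_add del: fls_plus_nth)
  have S_sum: "sum h I \<in> ?S" if "\<And>i. i \<in> I \<Longrightarrow> h i \<in> ?S" for h :: "int \<Rightarrow> qop" and I
    using that
  proof (induction I rule: infinite_finite_induct)
    case (insert i I)
    then show ?case using S_add[of "h i" "sum h I"] by simp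
  qed simp_all
  have S_single: "Poly_Mapping.single j f \<in> ?S" if "?fs f" for j f
    using that by (simp add: lookup_single when_def)
  show "carrier (Lq q) \<subseteq> ?S"
    unfolding G
  proof
    fix P assume "P \<in> ?G"
    then show "P \<in> ?S"
    proof induction
      case one
      show ?case unfolding Dq_def by (simp add: S_single[simplified] del: single_one)
    next
      case (incl h)
      have "?fs (fls_const c)" "?fs fls_X" "?fs fls_X_inv" "?fs 1" for c
        by (simp_all add: fls_const_nth)
      then show ?case
        using incl S_single unfolding x_op_def x_inv_op_def y_op_def y_inv_op_def by blast
    next
      case (a_inv h)
      then show ?case by (simp add: neg)
    next
      case (eng_add P R)
      then show ?case using S_add by (simp add: Dq_def)
    next
      case (eng_mult P R)
      have "qop_mult q P R \<in> ?S" unfolding qop_mult_def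
        by (intro S_sum S_single fs_mult fs_dilate) (use eng_mult in auto)
      then show ?case by (simp add: Dq_def)
    qed
  qed
  have m: "qop_mult q P R \<in> ?G" if "P \<in> ?G" "R \<in> ?G" for P R
    using generate_ring.eng_mult[OF that] by (simp add: Dq_def)
  have one: "Poly_Mapping.single 0 1 \<in> ?G"
    using generate_ring.one[of "Dq q"] by (simp add: Dq_def)
  have "scalar_op 0 \<in> ?G"
    by (rule generate_ring.incl) blast
  then have zero: "0 \<in> ?G"
    by (simp only: fls_const_0 single_zero)
  have G_sum: "sum h I \<in> ?G" if "\<And>i. i \<in> I \<Longrightarrow> h i \<in> ?G" for h :: "int \<Rightarrow> qop" and I
    using that
  proof (induction I rule: infinite_finite_induct)
    case (insert i I)
    then show ?case
      using generate_ring.eng_add[of "h i" "Dq q" _ "sum h I"] by (simp add: Dq_def)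
  qed (use zero in simp_all)
  have gens: "Poly_Mapping.single 0 (fls_const c) \<in> ?G" "Poly_Mapping.single 0 fls_X \<in> ?G"
      "Poly_Mapping.single 0 fls_X_inv \<in> ?G" "Poly_Mapping.single 1 1 \<in> ?G"
      "Poly_Mapping.single (- 1) 1 \<in> ?G" for c
    by (auto intro!: generate_ring.incl simp: x_op_def x_inv_op_def y_op_def y_inv_op_def)
  have Gx: "Poly_Mapping.single 0 (fls_shift i 1) \<in> ?G" for i
  proof (induction i rule: int_induct[of _ 0])
    case base
    then show ?case using one by simp
  next
    case (step1 i)
    then show ?case using m[OF gens(3) step1(2)]
      by (simp add: qop_mult_single fls_X_inv_times_conv_shift)
  next
    case (step2 i)
    then show ?case using m[OF gens(2) step2(2)]
      by (simp add: qop_mult_single fls_X_times_conv_shift)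
  qed
  have Gy: "Poly_Mapping.single j 1 \<in> ?G" for j
  proof (induction j rule: int_induct[of _ 0])
    case base
    then show ?case using one by simp
  next
    case (step1 i)
    then show ?case using m[OF gens(4) step1(2)] by (simp add: qop_mult_single add.commute)
  next
    case (step2 i)
    then show ?case using m[OF gens(5) step2(2)] by (simp add: qop_mult_single)
  qed
  have Gmon: "Poly_Mapping.single j (fls_const c * fls_shift i 1) \<in> ?G" for i j c
    using m[OF m[OF gens(1) Gx] Gy] by (simp add: qop_mult_single)
  show "?S \<subseteq> carrier (Lq q)"
    unfolding G
  proof
    fix P assume P: "P \<in> ?S"
    have "P = (\<Sum>j\<in>Poly_Mapping.keys P. \<Sum>i | fls_nth (Poly_Mapping.lookup P j) i \<noteq> 0.
        Poly_Mapping.single j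
          (fls_const (fls_nth (Poly_Mapping.lookup P j) i) * fls_shift (- i) 1))" (is "_ = ?T")
    proof (rule poly_mapping_eqI, rule fls_eqI)
      fix k n
      have fin: "?fs (Poly_Mapping.lookup P j)" for j using P by blast
      have "fls_nth (Poly_Mapping.lookup ?T k) n =
          (\<Sum>j\<in>Poly_Mapping.keys P. \<Sum>i | fls_nth (Poly_Mapping.lookup P j) i \<noteq> 0.
             if j = k then (if i = n then fls_nth (Poly_Mapping.lookup P j) i else 0) else 0)"
        by (simp add: lookup_sum fls_nth_sum lookup_single when_def if_distribR
            cong: if_cong) (intro sum.cong, auto)
      also have "\<dots> = (\<Sum>j\<in>Poly_Mapping.keys P.
          if j = k then fls_nth (Poly_Mapping.lookup P k) n else 0)"
        by (intro sum.cong) (auto simp: fin)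
      also have "\<dots> = fls_nth (Poly_Mapping.lookup P k) n"
        by (auto simp: in_keys_iff)
      finally show "fls_nth (Poly_Mapping.lookup P k) n = fls_nth (Poly_Mapping.lookup ?T k) n" ..
    qed
    also have "\<dots> \<in> ?G"
      by (intro G_sum Gmon)
    finally show "P \<in> ?G" .
  qed
qed

end

theory Submission
  imports Defs
begin

text \<open>
  The algebra of q-difference operators acts on Laurent series in a variable \<open>t\<close>: \<open>x\<close> multiplies by
  \<open>t\<^sup>b\<close>, and \<open>y\<close> sends \<open>t\<^sup>k\<close> to a multiple of \<open>t\<^sup>k\<^sup>-\<^sup>a\<close>, with the multiples chosen so that \<open>Q\<close>
  annihilates \<open>1\<close>. Division by \<open>Q\<close> leaves remainders of \<open>y\<close>-degree between \<open>0\<close> and \<open>b - 1\<close>, and for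
  these the exponents \<open>b n - a j\<close> are pairwise distinct since \<open>a\<close> and \<open>b\<close> are coprime; hence \<open>J\<^sub>Q\<close> is
  the annihilator of \<open>1\<close>. The operator \<open>K = x\<^sup>a y\<^sup>b\<close> is diagonal with the pairwise distinct
  eigenvalues \<open>lam q\<^sup>-\<^sup>k\<close> on \<open>t\<^sup>k\<close>. Subtracting eigenvalues from \<open>K\<close> shrinks the support of a
  series (modulo \<open>b\<close>, in the case of infinite support), so every nonzero submodule contains a
  monomial, and monomials are carried to each other by \<open>x\<close> and \<open>y\<close>.

  The annihilator of \<open>1\<close> in \<open>A\<^sub>q(2)\<close> is the left ideal generated by \<open>K - lam\<close>. If \<open>v\<close> generates a
  simple module and has eigenvalue \<open>q\<^sup>m lam\<close>, then a suitable \<open>x\<^sup>n y\<^sup>j v\<close> is a nonzero eigenvector with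
  eigenvalue \<open>lam\<close>, and sending \<open>1\<close> to it defines the isomorphism.
\<close>

section \<open>Monomials\<close>

text \<open>\<open>fls_shift\<close> lowers exponents, hence the minus sign.\<close>

definition fls_monom :: "complex \<Rightarrow> int \<Rightarrow> complex fls" where
  "fls_monom c k = fls_shift (- k) (fls_const c)"

lemma fls_nth_monom [simp]: "fls_nth (fls_monom c k) m = (if m = k then c else 0)"
  by (simp add: fls_monom_def fls_const_nth)

lemma fls_monom_0 [simp]: "fls_monom 0 k = 0"
  by (rule fls_eqI) simp

lemma fls_monom_eq_0_iff [simp]: "fls_monom c k = 0 \<longleftrightarrow> c = 0"
  by (metis fls_monom_0 fls_nth_monom fls_zero_nth)

lemma fls_monom_mult_nth [simp]: "fls_nth (fls_monom c k * f) m = c * fls_nth f (m - k)"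
  by (simp add: fls_monom_def fls_shifted_times_simps)

lemma fls_monom_mult [simp]: "fls_monom c k * fls_monom d l = fls_monom (c * d) (k + l)"
  by (rule fls_eqI) auto

lemma fls_dilate_monom [simp]: "fls_dilate d (fls_monom c k) = fls_monom (d powi k * c) k"
  by (rule fls_eqI) auto

text \<open>The operator \<open>c x^n y^j\<close>.\<close>

definition qmon :: "complex \<Rightarrow> int \<Rightarrow> int \<Rightarrow> qop" where
  "qmon c n j = Poly_Mapping.single j (fls_monom c n)"

text \<open>Moving \<open>y^i\<close> past \<open>x^m\<close> costs the factor
  \<open>q^(- i m)\<close>.\<close>

lemma qmon_mult:
  "qop_mult q (qmon c n i) (qmon d m j) = qmon (c * d * q powi (- i * m)) (n + m) (i + j)"
proof -
  have "(q powi - i) powi m = q powi (- i * m)"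
    by (simp only: power_int_mult)
  then show ?thesis
    by (simp add: qmon_def qop_mult_single mult_ac)
qed

lemma generators_eq_qmon:
  "scalar_op c = qmon c 0 0" "Poly_Mapping.single 0 1 = qmon 1 0 0"
  "x_op = qmon 1 1 0" "x_inv_op = qmon 1 (- 1) 0" "y_op = qmon 1 0 1" "y_inv_op = qmon 1 0 (- 1)"
  by (auto simp: qmon_def x_op_def x_inv_op_def y_op_def y_inv_op_def fls_const_nth
      simp del: single_one intro!: arg_cong[of _ _ "Poly_Mapping.single _"] fls_eqI)

section \<open>The action on Laurent series in t\<close>

text \<open>
  The multiples are found by trying \<open>y\<^sup>i t\<^sup>k = c\<^sup>i s\<^bsup>a i i - 2 i k\<^esup> t\<^bsup>k - a i\<^esup>\<close>: this is additive in \<open>i\<close>,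
  the relation with \<open>x\<close> forces \<open>s\<^bsup>2 b\<^esup> = q\<close>, and the condition on \<open>Q\<close> fixes \<open>c\<^sup>b\<close>.
\<close>

locale q_weights =
  fixes q lam s c :: complex and a b :: nat
  assumes q_nonzero: "q \<noteq> 0" and q_generic: "n > 0 \<Longrightarrow> q ^ n \<noteq> 1"
    and a_pos: "a > 0" and b_pos: "b > 0" and coprime: "coprime a b" and lam_nonzero: "lam \<noteq> 0"
    and s_root: "s ^ (2 * b) = q" and c_root: "c ^ b = lam * s powi (- int (a * b * b))"
begin

lemma s_nonzero [simp]: "s \<noteq> 0"
  using s_root q_nonzero b_pos by auto

lemma c_nonzero [simp]: "c \<noteq> 0"
  using c_root lam_nonzero b_pos by (metis mult_eq_0_iff power_int_eq_0_iff s_nonzero zero_power)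

text \<open>Turns every twist by \<open>q\<close> into a power of \<open>s\<close>, so that
  exponents can be added.\<close>

lemma q_powi: "q powi m = s powi (2 * int b * m)"
proof -
  have "s powi (2 * int b) = q"
    by (metis of_nat_mult of_nat_numeral power_int_of_nat s_root)
  then show ?thesis
    by (simp add: power_int_mult)
qed

text \<open>The factor in \<open>y^i t^k = y_weight i k * t^(k - a i)\<close>.\<close>

definition y_weight :: "int \<Rightarrow> int \<Rightarrow> complex" where
  "y_weight i k = c powi i * s powi (int a * i * i - 2 * i * k)"

lemma y_weight_nonzero [simp]: "y_weight i k \<noteq> 0"
  by (simp add: y_weight_def)

lemma y_weight_0 [simp]: "y_weight 0 k = 1"
  by (simp add: y_weight_def)

text \<open>The cross term \<open>2 a i j\<close> of the square accounts for the shift of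
  \<open>k\<close> by \<open>a * j\<close>, so that acting by \<open>y^j\<close> and then by
  \<open>y^i\<close> is acting by \<open>y^(i + j)\<close>.\<close>

lemma y_weight_add: "y_weight (i + j) k = y_weight i (k - int a * j) * y_weight j k"
  by (simp add: y_weight_def power_int_add[symmetric] algebra_simps flip: power_int_add)

text \<open>The choice of \<open>c\<close> cancels \<open>s^(a b b)\<close> and leaves
  \<open>lam * s^(- 2 b k)\<close>. At \<open>k = 0\<close> this says that \<open>y^b\<close> and
  \<open>lam x^(- a)\<close> agree on \<open>1\<close>.\<close>

lemma y_weight_b: "y_weight (int b) k = lam * q powi (- k)"
proof -
  have "c powi (int b) = lam * s powi (- int (a * b * b))"
    by (simp add: c_root)
  then show ?thesis
    by (simp add: q_powi y_weight_def algebra_simps flip: power_int_add)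
qed

text \<open>A dilation supplies the part of the weight that depends on \<open>k\<close>, so the
  result is a Laurent series by construction.\<close>

definition y_act :: "int \<Rightarrow> complex fls \<Rightarrow> complex fls" where
  "y_act i g = fls_shift (int a * i)
     (fls_const (c powi i * s powi (int a * i * i)) * fls_dilate (s powi (- 2 * i)) g)"

lemma fls_nth_y_act [simp]:
  "fls_nth (y_act i g) m = y_weight i (m + int a * i) * fls_nth g (m + int a * i)"
proof -
  have "(s powi (- 2 * i)) powi (m + int a * i) = s powi (- 2 * i * (m + int a * i))"
    by (simp only: power_int_mult)
  then show ?thesis
    by (simp add: y_act_def y_weight_def algebra_simps flip: power_int_add)
qed

lemma y_act_add: "y_act i (g + h) = y_act i g + y_act i h"
  by (rule fls_eqI) (simp add: algebra_simps)

lemma y_act_zero [simp]: "y_act i 0 = 0"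
  by (rule fls_eqI) simp

lemma y_act_monom [simp]: "y_act i (fls_monom d k) = fls_monom (y_weight i k * d) (k - int a * i)"
  by (rule fls_eqI) auto

lemma y_act_0 [simp]: "y_act 0 g = g"
  by (rule fls_eqI) simp

lemma y_act_y_act: "y_act i (y_act j g) = y_act (i + j) g"
  by (rule fls_eqI) (simp add: y_weight_add algebra_simps)

text \<open>The relation \<open>y^i f(x) = f(q^(- i) x) y^i\<close> on the module, where
  \<open>f(x)\<close> multiplies by \<open>fls_compose_power f b\<close>, that is, by
  \<open>f(t^b)\<close>.\<close>

lemma y_act_mult:
  "y_act i (fls_compose_power f b * g) = fls_compose_power (fls_dilate (q powi (- i)) f) b * y_act i g"
proof -
  have w: "(s powi (- 2 * i)) powi (int b * m) = (q powi (- i)) powi m" for m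
    by (simp add: q_powi flip: power_int_mult) (simp add: algebra_simps)
  have "fls_dilate (s powi (- 2 * i)) (fls_compose_power f b)
      = fls_compose_power (fls_dilate (q powi (- i)) f) b"
    by (rule fls_eqI)
      (use b_pos in \<open>auto simp: fls_nth_compose_power w simp del: mult_minus_left elim!: dvdE\<close>)
  then show ?thesis
    by (simp add: y_act_def fls_dilate_mult fls_shifted_times_simps mult_ac)
qed

definition act :: "qop \<Rightarrow> complex fls \<Rightarrow> complex fls" where
  "act P g = (\<Sum>i\<in>Poly_Mapping.keys P. fls_compose_power (Poly_Mapping.lookup P i) b * y_act i g)"

lemma act_superset:
  assumes "finite I" "Poly_Mapping.keys P \<subseteq> I"
  shows "act P g = (\<Sum>i\<in>I. fls_compose_power (Poly_Mapping.lookup P i) b * y_act i g)"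
  unfolding act_def by (rule sum.mono_neutral_left) (use assms in \<open>auto simp: in_keys_iff\<close>)

lemma act_single: "act (Poly_Mapping.single i f) g = fls_compose_power f b * y_act i g"
  by (subst act_superset[of "{i}"]) auto

lemma act_add_left: "act (P + R) g = act P g + act R g"
proof -
  let ?I = "Poly_Mapping.keys P \<union> Poly_Mapping.keys R \<union> Poly_Mapping.keys (P + R)"
  have "act S g = (\<Sum>i\<in>?I. fls_compose_power (Poly_Mapping.lookup S i) b * y_act i g)"
    if "S \<in> {P, R, P + R}" for S
    by (rule act_superset) (use that in auto)
  then show ?thesis
    by (simp add: lookup_add distrib_right sum.distrib)
qed

lemma act_zero_left [simp]: "act 0 g = 0"
  by (simp add: act_def)

lemma act_minus_left: "act (- P) g = - act P g"
  using act_add_left[of P "- P" g] by (simp add: eq_neg_iff_add_eq_0 add.commute)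

lemma act_diff_left: "act (P - R) g = act P g - act R g"
  using act_add_left[of P "- R" g] by (simp add: act_minus_left)

lemma act_add_right: "act P (g + h) = act P g + act P h"
  by (simp add: act_def y_act_add distrib_left sum.distrib)

lemma act_zero_right [simp]: "act P 0 = 0"
  by (simp add: act_def)

lemma act_mult: "act (qop_mult q P R) g = act P (act R g)"
proof (induction P rule: qop_induct)
  case (single i f)
  show ?case
  proof (induction R rule: qop_induct)
    case (single j h)
    show ?case
      by (simp add: qop_mult_single act_single y_act_mult y_act_y_act mult_ac)
  qed (simp_all add: qop_mult_add_right act_add_left act_add_right)
qed (simp_all add: qop_mult_add_left act_add_left)

lemma act_qmon [simp]:
  "act (qmon d n j) (fls_monom e k) = fls_monom (d * e * y_weight j k) (k + int b * n - int a * j)"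
proof -
  have "fls_compose_power (fls_monom d n) b = fls_monom d (int b * n)"
    by (simp add: fls_monom_def b_pos)
  then show ?thesis
    by (simp add: qmon_def act_single mult_ac) (simp add: algebra_simps)
qed

lemma act_qmon_nth: "fls_nth (act (qmon d n j) g) m =
   d * y_weight j (m - int b * n + int a * j) * fls_nth g (m - int b * n + int a * j)"
proof -
  have "fls_compose_power (fls_monom d n) b = fls_monom d (int b * n)"
    by (simp add: fls_monom_def b_pos)
  then show ?thesis
    by (simp add: qmon_def act_single)
qed

end

section \<open>The ideal J as an annihilator\<close>

lemma qop_mult_minus_left: "qop_mult q (- P) R = - qop_mult q P R"
  using qop_mult_add_left[of q P "- P" R] by (simp add: eq_neg_iff_add_eq_0 add.commute)

lemma qop_mult_minus_right: "qop_mult q P (- R) = - qop_mult q P R"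
  using qop_mult_add_right[of q P R "- R"] by (simp add: eq_neg_iff_add_eq_0 add.commute)

lemma qop_mult_diff_left: "qop_mult q (P - P') R = qop_mult q P R - qop_mult q P' R"
  using qop_mult_add_left[of q P "- P'" R] by (simp add: qop_mult_minus_left)

lemma qop_mult_diff_right: "qop_mult q P (R - R') = qop_mult q P R - qop_mult q P R'"
  using qop_mult_add_right[of q P R "- R'"] by (simp add: qop_mult_minus_right)

lemma Dq_simps [simp]:
  "carrier (Dq q) = UNIV" "mult (Dq q) = qop_mult q" "one (Dq q) = qmon 1 0 0"
  "zero (Dq q) = 0" "add (Dq q) = (+)"
  by (simp_all add: Dq_def generators_eq_qmon(2)[symmetric] del: single_one)

lemma Dq_uminus: "q \<noteq> 0 \<Longrightarrow> \<ominus>\<^bsub>Dq q\<^esub> P = - P"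
proof -
  assume "q \<noteq> 0"
  then interpret ring "Dq q" by (rule ring_Dq)
  show ?thesis by (rule minus_equality) simp_all
qed

lemma qmon_x_power:
  assumes "mult R = qop_mult q" "one R = qmon 1 0 0"
  shows "(qmon 1 i 0 [^]\<^bsub>R\<^esub> n) = qmon 1 (int n * i) 0"
  by (induction n) (simp_all add: nat_pow_def assms qmon_mult algebra_simps)

lemma qmon_y_power:
  assumes "mult R = qop_mult q" "one R = qmon 1 0 0"
  shows "(qmon 1 0 i [^]\<^bsub>R\<^esub> n) = qmon 1 0 (int n * i)"
  by (induction n) (simp_all add: nat_pow_def assms qmon_mult algebra_simps)

lemma Q_op_eq:
  assumes "q \<noteq> 0"
  shows "Q_op q a b lam = qmon 1 0 (int b) - qmon lam (- int a) 0"
  by (simp add: Q_op_def a_minus_def Dq_uminus assms generators_eq_qmon(1,4,5)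
      qmon_x_power[of _ q] qmon_y_power[of _ q] qmon_mult)

lemma K_op_eq: "K_op q a b = qmon 1 (int a) (int b)"
  by (simp add: K_op_def Aq_def gen_subalgebra_def generators_eq_qmon(3,5)
      qmon_x_power[of _ q] qmon_y_power[of _ q] qmon_mult)

context q_weights
begin

abbreviation "Q \<equiv> Q_op q a b lam"
abbreviation "J \<equiv> J_Q q a b lam"

lemma one_eq_fls_monom: "1 = fls_monom 1 0"
  by (rule fls_eqI) auto

lemma act_one [simp]: "act (qmon 1 0 0) g = g"
  by (rule fls_eqI) (simp add: act_qmon_nth)

lemma act_Q: "act Q 1 = 0"
  by (simp add: Q_op_eq q_nonzero act_diff_left one_eq_fls_monom y_weight_b mult_ac)

lemma J_alt: "J = range (\<lambda>S. qop_mult q S Q)"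
  by (auto simp: J_Q_def)

lemma zero_in_J: "0 \<in> J"
  unfolding J_alt by (metis qop_mult_0(1) rangeI)

lemma J_add: "P \<in> J \<Longrightarrow> R \<in> J \<Longrightarrow> P + R \<in> J"
  unfolding J_alt by (auto simp: qop_mult_add_left[symmetric])

lemma J_diff: "P \<in> J \<Longrightarrow> R \<in> J \<Longrightarrow> P - R \<in> J"
  unfolding J_alt by (auto simp: qop_mult_diff_left[symmetric])

lemma act_J: "P \<in> J \<Longrightarrow> act P 1 = 0"
  unfolding J_alt by (auto simp: act_mult act_Q)

lemma single_mult_Q: "qop_mult q (Poly_Mapping.single i f) Q = Poly_Mapping.single (i + int b) f
    - Poly_Mapping.single i (f * fls_dilate (q powi - i) (fls_monom lam (- int a)))"
proof -
  have "fls_monom 1 0 = 1"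
    by (simp add: one_eq_fls_monom)
  then show ?thesis
    by (simp add: Q_op_eq q_nonzero qop_mult_diff_right qmon_def qop_mult_single
        del: fls_dilate_monom)
qed

text \<open>Modulo \<open>J\<close>, \<open>y^b\<close> may be replaced by
  \<open>lam x^(- a)\<close>, which lowers the \<open>y\<close>-degree by \<open>b\<close>. Negative
  degrees are raised by the inverse step, since \<open>lam x^(- a)\<close> is a unit among the
  coefficients.\<close>

lemma single_reduce:
  "\<exists>g. Poly_Mapping.single (r + int b * k) f - Poly_Mapping.single r g \<in> J"
proof (induction k arbitrary: f rule: int_induct[of _ 0])
  case base
  show ?case
    by (intro exI[of _ f]) (simp add: zero_in_J)
next
  case (step1 k)
  define h where "h = fls_dilate (q powi - (r + int b * k)) (fls_monom lam (- int a))"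
  obtain g where g: "Poly_Mapping.single (r + int b * k) (f * h) - Poly_Mapping.single r g \<in> J"
    using step1 by blast
  have "qop_mult q (Poly_Mapping.single (r + int b * k) f) Q \<in> J"
    unfolding J_alt by blast
  from J_add[OF this g] show ?case
    by (auto simp: single_mult_Q h_def algebra_simps)
next
  case (step2 k)
  define i where "i = r + int b * (k - 1)"
  define h where "h = fls_dilate (q powi - i) (fls_monom lam (- int a))"
  \<comment> \<open>A nonzero Laurent series is invertible; with the coefficient
    \<open>f / h\<close>, multiplying by \<open>Q\<close> produces \<open>f\<close> itself, up to
    sign, in degree \<open>i\<close>.\<close>
  have "h \<noteq> 0"
    using lam_nonzero q_nonzero by (simp add: h_def)
  then have fh: "f / h * h = f"
    by simp
  obtain g where g: "Poly_Mapping.single (r + int b * k) (f / h) - Poly_Mapping.single r g \<in> J"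
    using step2 by blast
  have ib: "i + int b = r + int b * k"
    by (simp add: i_def algebra_simps)
  have "qop_mult q (Poly_Mapping.single i (f / h)) Q
      = Poly_Mapping.single (r + int b * k) (f / h) - Poly_Mapping.single i f"
    unfolding single_mult_Q h_def[symmetric] fh ib ..
  moreover have "qop_mult q (Poly_Mapping.single i (f / h)) Q \<in> J"
    unfolding J_alt by blast
  ultimately have "Poly_Mapping.single (r + int b * k) (f / h) - Poly_Mapping.single i f \<in> J"
    by simp
  from J_diff[OF g this] show ?case
    by (auto simp: i_def)
qed

lemma reduce: "\<exists>R. Poly_Mapping.keys R \<subseteq> {0..<int b} \<and> P - R \<in> J"
proof (induction P rule: qop_induct)
  case zero
  show ?case
    by (intro exI[of _ 0]) (simp add: zero_in_J)
next
  case (single i f)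
  obtain g where "Poly_Mapping.single (i mod int b + int b * (i div int b)) f
      - Poly_Mapping.single (i mod int b) g \<in> J"
    using single_reduce by blast
  then show ?case
    using b_pos by (intro exI[of _ "Poly_Mapping.single (i mod int b) g"]) auto
next
  case (add P R)
  then obtain P' R' where PR: "Poly_Mapping.keys P' \<subseteq> {0..<int b}" "P - P' \<in> J"
      "Poly_Mapping.keys R' \<subseteq> {0..<int b}" "R - R' \<in> J"
    by blast
  have "Poly_Mapping.keys (P' + R') \<subseteq> {0..<int b}"
    using PR keys_add[of P' R'] by blast
  moreover have "P + R - (P' + R') \<in> J"
    using J_add[OF PR(2,4)] by (simp add: algebra_simps)
  ultimately show ?case
    by blast
qed

text \<open>Since \<open>y^i\<close> takes \<open>1\<close> to a multiple of
  \<open>t^(- a i)\<close>, the coefficient of \<open>x^n y^i\<close> contributes only at the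
  exponent \<open>b n - a i\<close>.\<close>

lemma act_one_nth: "fls_nth (act P 1) m = (\<Sum>i\<in>Poly_Mapping.keys P.
    if int b dvd m + int a * i
    then y_weight i 0 * fls_nth (Poly_Mapping.lookup P i) ((m + int a * i) div int b) else 0)"
  unfolding act_def fls_nth_sum
proof (rule sum.cong[OF refl])
  fix i
  show "fls_nth (fls_compose_power (Poly_Mapping.lookup P i) b * y_act i 1) m =
    (if int b dvd m + int a * i
     then y_weight i 0 * fls_nth (Poly_Mapping.lookup P i) ((m + int a * i) div int b) else 0)"
    unfolding one_eq_fls_monom y_act_monom
    using b_pos by (subst mult.commute) (simp add: fls_nth_compose_power)
qed

lemma act_reduced_eq_0:
  assumes "Poly_Mapping.keys R \<subseteq> {0..<int b}" "act R 1 = 0"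
  shows "R = 0"
proof (rule poly_mapping_eqI, rule fls_eqI, rule ccontr)
  fix j n
  assume "fls_nth (Poly_Mapping.lookup R j) n \<noteq> fls_nth (Poly_Mapping.lookup 0 j) n"
  then have nz: "fls_nth (Poly_Mapping.lookup R j) n \<noteq> 0" by simp
  then have j: "j \<in> Poly_Mapping.keys R"
    by (auto simp: in_keys_iff)
  \<comment> \<open>The exponent at which the coefficient of \<open>x^n y^j\<close> arrives. No
    other \<open>y\<close>-degree of \<open>R\<close> reaches it, since \<open>a\<close> is a unit
    modulo \<open>b\<close> and the degrees lie in \<open>{0..<b}\<close>.\<close>
  let ?m = "int b * n - int a * j"
  have eq: "int b dvd ?m + int a * i \<longleftrightarrow> i = j" if "i \<in> Poly_Mapping.keys R" for i
  proof
    assume "int b dvd ?m + int a * i"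
    then have "int b dvd int b * n + int a * (i - j)"
      by (simp add: algebra_simps)
    then have "int b dvd int a * (i - j)"
      by (simp add: dvd_add_right_iff)
    then have "int b dvd i - j"
      using coprime by (simp add: coprime_dvd_mult_right_iff coprime_commute)
    moreover have "\<bar>i - j\<bar> < int b"
      using subsetD[OF assms(1) that] subsetD[OF assms(1) j] by auto
    ultimately show "i = j"
      by (metis dvd_imp_le_int eq_iff_diff_eq_0 not_le abs_of_nat)
  qed simp
  have "fls_nth (act R 1) ?m = (\<Sum>i\<in>Poly_Mapping.keys R. if i = j
      then y_weight j 0 * fls_nth (Poly_Mapping.lookup R j) n else 0)"
    unfolding act_one_nth using b_pos by (intro sum.cong) (auto simp: eq)
  then show False
    using assms(2) nz j by simp
qed

text \<open>The remainder of an annihilator of \<open>1\<close> on division by \<open>Q\<close>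
  again annihilates \<open>1\<close>, hence is zero.\<close>

theorem J_eq_annihilator: "J = {P. act P 1 = 0}"
proof (intro equalityI subsetI CollectI)
  fix P assume P: "P \<in> {P. act P 1 = 0}"
  obtain R where R: "Poly_Mapping.keys R \<subseteq> {0..<int b}" "P - R \<in> J"
    using reduce by blast
  have "act R 1 = 0"
    using act_J[OF R(2)] P by (simp add: act_diff_left)
  then have "R = 0"
    using R(1) by (rule act_reduced_eq_0[rotated])
  then show "P \<in> J"
    using R(2) by simp
qed (rule act_J)

end

section \<open>Transitivity of the action\<close>

text \<open>Adding a multiple of \<open>(a, b)\<close> to a Bezout solution \<open>(n, j)\<close>
  does not change \<open>b n - a j\<close>, and a large one makes both entries nonnegative. Thus
  nonnegative powers of \<open>x\<close> and \<open>y\<close> reach every power of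
  \<open>t\<close>.\<close>

lemma exists_nat_combination:
  assumes "coprime a b" "a > 0" "b > 0"
  shows "\<exists>n j :: nat. int b * int n - int a * int j = d"
proof -
  obtain u v where uv: "u * int a + v * int b = 1"
    using assms(1) bezout_int[of "int a" "int b"] by auto
  define t where "t = \<bar>u * d\<bar> + \<bar>v * d\<bar>"
  have "t \<le> t * int a" "t \<le> t * int b"
    using assms(2,3) by (auto simp: t_def mult_le_cancel_left1)
  then have "0 \<le> v * d + t * int a" "0 \<le> - u * d + t * int b"
    unfolding t_def by linarith+
  moreover have "int b * (v * d + t * int a) - int a * (- u * d + t * int b)
      = (u * int a + v * int b) * d"
    by (simp add: algebra_simps)
  ultimately show ?thesis
    unfolding uv by (intro exI[of _ "nat (v * d + t * int a)"] exI[of _ "nat (- u * d + t * int b)"]) simp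
qed

section \<open>Subrings, and \<open>Aq q\<close> in terms of coefficients\<close>

lemma subring_Aq: "q \<noteq> 0 \<Longrightarrow> subring (carrier (Aq q)) (Dq q)"
  unfolding Aq_def by (rule subring_gen_subalgebra)

lemma subring_Lq: "q \<noteq> 0 \<Longrightarrow> subring (carrier (Lq q)) (Dq q)"
  unfolding Lq_def by (rule subring_gen_subalgebra)

lemma
  assumes "subring S (Dq q)"
  shows subring_mult: "P \<in> S \<Longrightarrow> R \<in> S \<Longrightarrow> qop_mult q P R \<in> S"
    and subring_add: "P \<in> S \<Longrightarrow> R \<in> S \<Longrightarrow> P + R \<in> S"
    and subring_one: "qmon 1 0 0 \<in> S"
  using subringE(3,6,7)[OF assms] by simp_all

lemma
  assumes "q \<noteq> 0" "subring S (Dq q)"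
  shows subring_uminus: "P \<in> S \<Longrightarrow> - P \<in> S"
    and subring_diff: "P \<in> S \<Longrightarrow> R \<in> S \<Longrightarrow> P - R \<in> S"
    and subring_zero: "0 \<in> S"
proof -
  show m: "- P \<in> S" if "P \<in> S" for P
    using subringE(5)[OF assms(2) that] by (simp add: Dq_uminus assms(1))
  show "P \<in> S \<Longrightarrow> R \<in> S \<Longrightarrow> P - R \<in> S"
    using subring_add[OF assms(2), of P "- R"] m[of R] by simp
  show "0 \<in> S"
    using subringE(2)[OF assms(2)] by simp
qed

lemma Aq_generators: "qmon c 0 0 \<in> carrier (Aq q)" "qmon 1 1 0 \<in> carrier (Aq q)"
    "qmon 1 0 1 \<in> carrier (Aq q)"
  unfolding Aq_def gen_subalgebra_def generators_eq_qmon[symmetric]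
  by (auto intro!: generate_ring.incl simp: generators_eq_qmon)

lemma qmon_in_Aq:
  assumes "q \<noteq> 0" "n \<ge> 0" "j \<ge> 0"
  shows "qmon c n j \<in> carrier (Aq q)"
proof -
  note mult = subring_mult[OF subring_Aq[OF assms(1)]]
  have x: "qmon 1 (int m) 0 \<in> carrier (Aq q)" for m
  proof (induction m)
    case (Suc m)
    from mult[OF Aq_generators(2) this] show ?case
      by (simp add: qmon_mult)
  qed (simp add: Aq_generators(1))
  have y: "qmon 1 0 (int m) \<in> carrier (Aq q)" for m
  proof (induction m)
    case (Suc m)
    from mult[OF Aq_generators(3) this] show ?case
      by (simp add: qmon_mult)
  qed (simp add: Aq_generators(1))
  have "qmon c (int (nat n)) (int (nat j)) \<in> carrier (Aq q)"
    using mult[OF mult[OF Aq_generators(1)[of c] x[of "nat n"]] y[of "nat j"]] by (simp add: qmon_mult)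
  then show ?thesis
    using assms by simp
qed

text \<open>Finiteness comes from the larger algebra, and nonnegativity of the exponents passes
  through products. Membership is thus read off coefficients, as in
  \<open>A_inter_J\<close>.\<close>

lemma Aq_carrier:
  assumes "q \<noteq> 0"
  shows "carrier (Aq q) = {P. \<forall>j. finite {i. fls_nth (Poly_Mapping.lookup P j) i \<noteq> 0} \<and>
    (\<forall>i. i < 0 \<or> j < 0 \<longrightarrow> fls_nth (Poly_Mapping.lookup P j) i = 0)}"
    (is "_ = ?S")
proof
  let ?pos = "\<lambda>P. \<forall>j i. i < 0 \<or> j < 0 \<longrightarrow> fls_nth (Poly_Mapping.lookup P j) i = 0"
  have pos_add: "?pos (P + R)" if "?pos P" "?pos R" for P R
    using that by (simp add: lookup_add)
  have pos_sum: "?pos (sum h I)" if "\<And>i. i \<in> I \<Longrightarrow> ?pos (h i)" for h :: "int \<Rightarrow> qop" and I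
    using that
  proof (induction I rule: infinite_finite_induct)
    case (insert i I)
    then show ?case using pos_add[of "h i" "sum h I"] by simp
  qed simp_all
  have pos_mult: "?pos (qop_mult q P R)" if PR: "?pos P" "?pos R" for P R
    unfolding qop_mult_def
  proof (intro pos_sum)
    fix i k
    let ?f = "Poly_Mapping.lookup P i" and ?g = "fls_dilate (q powi - i) (Poly_Mapping.lookup R k)"
    have "fls_nth (?f * ?g) n = 0" if n: "n < 0 \<or> i + k < 0" for n
      unfolding fls_times_nth(2)
    proof (rule sum.neutral, rule ballI)
      fix l
      \<comment> \<open>A negative sum of exponents has a negative summand.\<close>
      have "(l < 0 \<or> i < 0) \<or> (n - l < 0 \<or> k < 0)"
        using n by linarith
      then have "fls_nth ?f l = 0 \<or> fls_nth (Poly_Mapping.lookup R k) (n - l) = 0"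
        using PR by blast
      then show "fls_nth ?f l * fls_nth ?g (n - l) = 0"
        by auto
    qed
    then show "?pos (Poly_Mapping.single (i + k) (?f * ?g))"
      by (simp add: lookup_single when_def)
  qed
  show "carrier (Aq q) \<subseteq> ?S"
  proof
    fix P
    assume P: "P \<in> carrier (Aq q)"
    then have "P \<in> generate_ring (Dq q) (range scalar_op \<union> {x_op, y_op})"
      by (simp add: Aq_def gen_subalgebra_def)
    then have "?pos P"
    proof induction
      case one
      show ?case by (simp add: qmon_def lookup_single when_def)
    next
      case (incl h)
      then show ?case
        by (auto simp: generators_eq_qmon qmon_def lookup_single when_def split: if_splits)
    next
      case (a_inv h)
      then show ?case by (simp add: Dq_uminus assms)
    next
      case (eng_add P R)
      then show ?case using pos_add[of P R] by simp
    next
      case (eng_mult P R)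
      then show ?case using pos_mult[of P R] by simp
    qed
    then show "P \<in> ?S"
      using P Aq_subset_Lq[of q] Lq_carrier[OF assms] by blast
  qed
  show "?S \<subseteq> carrier (Aq q)"
  proof
    fix P
    assume P: "P \<in> ?S"
    note A = subring_Aq[OF assms]
    have A_sum: "sum h I \<in> carrier (Aq q)" if "\<And>i. i \<in> I \<Longrightarrow> h i \<in> carrier (Aq q)"
      for h :: "int \<Rightarrow> qop" and I
      using that
      by (induction I rule: infinite_finite_induct)
        (auto simp: subring_zero[OF assms A] intro: subring_add[OF A])
    have "P = (\<Sum>j\<in>Poly_Mapping.keys P. \<Sum>i | fls_nth (Poly_Mapping.lookup P j) i \<noteq> 0.
        qmon (fls_nth (Poly_Mapping.lookup P j) i) i j)" (is "_ = ?T")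
    proof (rule poly_mapping_eqI, rule fls_eqI)
      fix k n
      have fin: "finite {i. fls_nth (Poly_Mapping.lookup P j) i \<noteq> 0}" for j
        using P by blast
      have "fls_nth (Poly_Mapping.lookup ?T k) n =
          (\<Sum>j\<in>Poly_Mapping.keys P. \<Sum>i | fls_nth (Poly_Mapping.lookup P j) i \<noteq> 0.
             if j = k then (if i = n then fls_nth (Poly_Mapping.lookup P j) i else 0) else 0)"
        unfolding lookup_sum fls_nth_sum
        by (intro sum.cong) (auto simp: qmon_def lookup_single when_def)
      also have "\<dots> = (\<Sum>j\<in>Poly_Mapping.keys P.
          if j = k then fls_nth (Poly_Mapping.lookup P k) n else 0)"
        by (intro sum.cong) (auto simp: fin)
      also have "\<dots> = fls_nth (Poly_Mapping.lookup P k) n"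
        by (auto simp: in_keys_iff)
      finally show "fls_nth (Poly_Mapping.lookup P k) n = fls_nth (Poly_Mapping.lookup ?T k) n" ..
    qed
    also have "\<dots> \<in> carrier (Aq q)"
      using P by (intro A_sum qmon_in_Aq assms) (auto simp: not_less[symmetric])
    finally show "P \<in> carrier (Aq q)" .
  qed
qed

section \<open>Transitivity of \<open>Aq q\<close> on series of finite support\<close>

context q_weights
begin

abbreviation "A \<equiv> carrier (Aq q)"
abbreviation "L \<equiv> carrier (Lq q)"
abbreviation "K \<equiv> K_op q a b"

lemma act_K_nth: "fls_nth (act K g) m = lam * q powi (- m) * fls_nth g m"
  by (simp add: K_op_eq act_qmon_nth y_weight_b mult.commute[of "int b"])

lemma act_scalar_nth: "fls_nth (act (qmon d 0 0) g) m = d * fls_nth g m"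
  by (simp add: act_qmon_nth)

text \<open>Makes the eigenvalues of \<open>K\<close> on the powers of \<open>t\<close> pairwise
  distinct.\<close>

lemma q_powi_inj: "q powi m = q powi n \<longleftrightarrow> m = n"
proof
  have *: False if "q powi m = q powi n" "m < n" for m n
  proof -
    have "q powi (n - m) = 1"
      using that q_nonzero by (simp add: power_int_diff)
    then have "q ^ nat (n - m) = 1"
      using that by (simp add: power_int_def)
    then show False
      using q_generic[of "nat (n - m)"] that by simp
  qed
  show "q powi m = q powi n \<Longrightarrow> m = n"
    using *[of m n] *[of n m] by (cases m n rule: linorder_cases) auto
qed simp

text \<open>\<open>x^n y^j\<close> shifts exponents by \<open>b n - a j\<close>, which takes every
  integer value with \<open>n\<close> and \<open>j\<close> nonnegative; the scalar divides out the
  weight.\<close>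

lemma monom_to_monom:
  assumes "d \<noteq> 0"
  shows "\<exists>S\<in>A. act S (fls_monom d k) = fls_monom e m"
proof -
  obtain n j where nj: "int b * int n - int a * int j = m - k"
    using exists_nat_combination[OF coprime a_pos b_pos] by blast
  show ?thesis
  proof (rule bexI)
    show "act (qmon (e / (d * y_weight (int j) k)) (int n) (int j)) (fls_monom d k) = fls_monom e m"
      using nj assms by simp (simp add: algebra_simps)
  qed (simp add: qmon_in_Aq q_nonzero)
qed

lemma finite_support_to_monom:
  assumes "finite {m. fls_nth g m \<noteq> 0}" "g \<noteq> 0"
  shows "\<exists>S\<in>A. \<exists>d k. d \<noteq> 0 \<and> act S g = fls_monom d k"
  using assms
proof (induction "card {m. fls_nth g m \<noteq> 0}" arbitrary: g rule: less_induct)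
  case less
  obtain k where k: "fls_nth g k \<noteq> 0"
    using less.prems(2) unfolding fls_nonzero_nth by blast
  \<comment> \<open>Kills the term of exponent \<open>k\<close> and multiplies the others by nonzero
    scalars, so the support loses exactly \<open>k\<close>.\<close>
  define S where "S = K - qmon (lam * q powi (- k)) 0 0"
  have SA: "S \<in> A"
    unfolding S_def K_op_eq
    by (intro subring_diff[OF q_nonzero] subring_Aq qmon_in_Aq q_nonzero) auto
  have nth: "fls_nth (act S g) m = lam * (q powi (- m) - q powi (- k)) * fls_nth g m" for m
    by (simp add: S_def act_diff_left act_K_nth act_scalar_nth algebra_simps)
  show ?case
  proof (cases "act S g = 0")
    case True
    have "fls_nth g m = 0" if "m \<noteq> k" for m
      using nth[of m] True that lam_nonzero by (simp add: q_powi_inj)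
    then have "g = fls_monom (fls_nth g k) k"
      by (intro fls_eqI) auto
    then have "act (qmon 1 0 0) g = fls_monom (fls_nth g k) k"
      by simp
    then show ?thesis
      using k qmon_in_Aq[OF q_nonzero, of 0 0 1] by blast
  next
    case False
    have "{m. fls_nth (act S g) m \<noteq> 0} \<subset> {m. fls_nth g m \<noteq> 0}"
      using k by (auto simp: nth)
    then have "card {m. fls_nth (act S g) m \<noteq> 0} < card {m. fls_nth g m \<noteq> 0}"
        "finite {m. fls_nth (act S g) m \<noteq> 0}"
      using less.prems(1) by (auto intro: psubset_card_mono finite_subset)
    then obtain S' d l where "S' \<in> A" "d \<noteq> 0" "act S' (act S g) = fls_monom d l"
      using less.hyps False by blast
    then show ?thesis
      using subring_mult[OF subring_Aq[OF q_nonzero] _ SA] by (metis act_mult)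
  qed
qed

text \<open>One monomial obtained from \<open>g\<close> suffices: each term of \<open>h\<close> is
  reached from it, and the operators are added.\<close>

lemma A_transitive:
  assumes "finite {m. fls_nth g m \<noteq> 0}" "g \<noteq> 0" "finite {m. fls_nth h m \<noteq> 0}"
  shows "\<exists>S\<in>A. act S g = h"
proof -
  obtain S d k where S: "S \<in> A" "d \<noteq> 0" "act S g = fls_monom d k"
    using finite_support_to_monom[OF assms(1,2)] by blast
  have "\<exists>T\<in>A. act T g = h"
    using assms(3)
  proof (induction "{m. fls_nth h m \<noteq> 0}" arbitrary: h rule: finite_induct)
    case empty
    then have "h = 0"
      by (intro fls_eqI) auto
    then show ?case
      using subring_zero[OF q_nonzero subring_Aq[OF q_nonzero]] by (intro bexI[of _ 0]) simp_all
  next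
    case (insert n F)
    define h' where "h' = h - fls_monom (fls_nth h n) n"
    have "F = {m. fls_nth h' m \<noteq> 0}"
      using insert(2,4) by (auto simp: h'_def)
    then obtain T where T: "T \<in> A" "act T g = h'"
      using insert(3) by blast
    obtain U where U: "U \<in> A" "act U (fls_monom d k) = fls_monom (fls_nth h n) n"
      using monom_to_monom[OF S(2)] by blast
    have "act (T + qop_mult q U S) g = h"
      by (simp add: act_add_left act_mult T S U h'_def)
    then show ?case
      using subring_add subring_mult subring_Aq[OF q_nonzero] T(1) U(1) S(1) by metis
  qed
  then show ?thesis .
qed

lemma finite_support_act_L:
  assumes "P \<in> L"
  shows "finite {m. fls_nth (act P 1) m \<noteq> 0}"
proof (rule finite_subset)
  let ?U = "\<lambda>i. (\<lambda>n. int b * n - int a * i) ` {n. fls_nth (Poly_Mapping.lookup P i) n \<noteq> 0}"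
  show "finite (\<Union>i\<in>Poly_Mapping.keys P. ?U i)"
    using assms by (simp add: Lq_carrier q_nonzero)
  show "{m. fls_nth (act P 1) m \<noteq> 0} \<subseteq> (\<Union>i\<in>Poly_Mapping.keys P. ?U i)"
  proof
    fix m
    assume "m \<in> {m. fls_nth (act P 1) m \<noteq> 0}"
    then obtain i where i: "i \<in> Poly_Mapping.keys P" "int b dvd m + int a * i"
        "fls_nth (Poly_Mapping.lookup P i) ((m + int a * i) div int b) \<noteq> 0"
      unfolding mem_Collect_eq act_one_nth
      by (elim sum.not_neutral_contains_not_neutral) (auto split: if_splits)
    then have "m \<in> ?U i"
      by (intro image_eqI[of _ _ "(m + int a * i) div int b"]) auto
    then show "m \<in> (\<Union>i\<in>Poly_Mapping.keys P. ?U i)"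
      using i(1) by blast
  qed
qed

text \<open>Congruence modulo \<open>J\<close> is equality after acting on \<open>1\<close>. The
  multiplier already lies in \<open>A\<close>, which serves simplicity over \<open>L\<close> and
  over \<open>A\<close> alike.\<close>

lemma L_transitive:
  assumes "R \<in> L" "R \<notin> J" "P \<in> L"
  shows "\<exists>S\<in>A. qop_mult q S R - P \<in> J"
proof -
  have "act R 1 \<noteq> 0"
    using assms(2) by (simp add: J_eq_annihilator)
  then obtain S where "S \<in> A" "act S (act R 1) = act P 1"
    using A_transitive finite_support_act_L assms(1,3) by blast
  then show ?thesis
    by (auto simp: J_eq_annihilator act_diff_left act_mult)
qed

end

section \<open>Transitivity of \<open>Dq q\<close> on all series\<close>

context q_weights
begin

text \<open>Replaces the support, which may be infinite, in the induction: there are at most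
  \<open>b\<close> residues.\<close>

definition residues :: "complex fls \<Rightarrow> int set" where
  "residues g = (\<lambda>m. m mod int b) ` {m. fls_nth g m \<noteq> 0}"

lemma finite_residues: "finite (residues g)"
  by (rule finite_subset[of _ "{0..<int b}"]) (use b_pos in \<open>auto simp: residues_def\<close>)

lemma residuesI: "fls_nth g m \<noteq> 0 \<Longrightarrow> m mod int b \<in> residues g"
  by (auto simp: residues_def)

lemma residues_compose_power_mult: "residues (fls_compose_power f b * g) \<subseteq> residues g"
proof
  fix r
  assume "r \<in> residues (fls_compose_power f b * g)"
  then obtain m where m: "r = m mod int b" "fls_nth (fls_compose_power f b * g) m \<noteq> 0"
    by (auto simp: residues_def)
  then obtain l where "fls_nth (fls_compose_power f b) l * fls_nth g (m - l) \<noteq> 0"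
    unfolding fls_times_nth(2) by (meson sum.neutral)
  then have l: "int b dvd l" "fls_nth g (m - l) \<noteq> 0"
    using b_pos by (auto simp: fls_nth_compose_power split: if_splits)
  then have "(m - l) mod int b = m mod int b"
    by (simp add: mod_eq_dvd_iff)
  then show "r \<in> residues g"
    using residuesI[OF l(2)] m(1) by simp
qed

text \<open>
  Dividing by the part of \<open>g\<close> with exponents congruent to \<open>k\<close> modulo \<open>b\<close>, which is \<open>t\<^sup>k\<close> times a
  series in \<open>x\<close>, turns that part into \<open>t\<^sup>k\<close>.
\<close>

lemma isolate_monom:
  assumes "fls_nth g k \<noteq> 0"
  shows "\<exists>f h. fls_compose_power f b * g = fls_monom 1 k + h \<and> residues h \<subseteq> residues g - {k mod int b}"
proof -
  define f where "f = Abs_fls (\<lambda>n. fls_nth g (k + int b * n))"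
  have f_nth: "fls_nth f n = fls_nth g (k + int b * n)" for n
    unfolding f_def
  proof (rule nth_Abs_fls_lower_bound[of "min 0 (fls_subdegree g - k)"], intro allI impI)
    fix n
    assume n: "n < min 0 (fls_subdegree g - k)"
    \<comment> \<open>\<open>n\<close> is negative, so \<open>b n\<close> is at most
      \<open>n\<close> and \<open>k + b n\<close> falls below the subdegree of
      \<open>g\<close>.\<close>
    then have "int b * n \<le> n"
      using b_pos by (simp add: mult_le_cancel_right1)
    with n show "fls_nth g (k + int b * n) = 0"
      by (intro fls_eq0_below_subdegree) linarith
  qed
  have "f \<noteq> 0"
    using f_nth[of 0] assms by auto
  \<comment> \<open>\<open>g'\<close> is \<open>g\<close> without the exponents congruent to
    \<open>k\<close>, as the next two facts show.\<close>
  define g' where "g' = g - fls_compose_power f b * fls_monom 1 k"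
  have "fls_nth (fls_compose_power f b * fls_monom 1 k) m
      = (if m mod int b = k mod int b then fls_nth g m else 0)" for m
    using b_pos by (subst mult.commute) (auto simp: fls_nth_compose_power f_nth mod_eq_dvd_iff)
  then have "fls_nth g' m = (if m mod int b = k mod int b then 0 else fls_nth g m)" for m
    by (simp add: g'_def)
  then have "residues g' \<subseteq> residues g - {k mod int b}"
    by (auto simp: residues_def split: if_splits)
  then have "residues (fls_compose_power (inverse f) b * g') \<subseteq> residues g - {k mod int b}"
    using residues_compose_power_mult by blast
  moreover have "fls_compose_power (inverse f) b * fls_compose_power f b = 1"
    using \<open>f \<noteq> 0\<close> b_pos by (simp flip: fls_compose_power_mult)
  then have "fls_compose_power (inverse f) b * g
      = fls_monom 1 k + fls_compose_power (inverse f) b * g'"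
    by (simp add: g'_def right_diff_distrib flip: mult.assoc)
  ultimately show ?thesis
    by blast
qed

text \<open>After isolating \<open>t^k\<close>, subtracting from \<open>K\<close> its eigenvalue on
  \<open>t^k\<close> removes that term and creates no residue, so the class of \<open>k\<close>
  disappears.\<close>

lemma act_to_one:
  assumes "g \<noteq> 0"
  shows "\<exists>S. act S g = 1"
  using assms
proof (induction "card (residues g)" arbitrary: g rule: less_induct)
  case less
  obtain k where k: "fls_nth g k \<noteq> 0"
    using less.prems unfolding fls_nonzero_nth by blast
  obtain f h where f: "fls_compose_power f b * g = fls_monom 1 k + h"
      and h: "residues h \<subseteq> residues g - {k mod int b}"
    using isolate_monom[OF k] by blast
  define u where "u = act (K - qmon (lam * q powi (- k)) 0 0) h"
  have nth: "fls_nth u m = lam * (q powi (- m) - q powi (- k)) * fls_nth h m" for m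
    by (simp add: u_def act_diff_left act_K_nth act_scalar_nth algebra_simps)
  have "act (Poly_Mapping.single 0 f) g = fls_monom 1 k + h"
    by (simp add: act_single f)
  then have u: "u = act (qop_mult q (K - qmon (lam * q powi (- k)) 0 0) (Poly_Mapping.single 0 f)) g"
    unfolding act_mult
    by (intro fls_eqI) (auto simp: nth act_diff_left act_K_nth act_scalar_nth algebra_simps)
  show ?case
  proof (cases "h = 0")
    case True
    obtain S where "act S (fls_monom 1 k) = fls_monom 1 0"
      using monom_to_monom[of 1 k 1 0] by auto
    then have "act (qop_mult q S (Poly_Mapping.single 0 f)) g = 1"
      by (simp add: act_mult act_single f True one_eq_fls_monom)
    then show ?thesis ..
  next
    case False
    have sub: "residues u \<subseteq> residues h"
      by (auto simp: residues_def nth)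
    have "k mod int b \<in> residues g"
      by (rule residuesI[OF k])
    then have "residues u \<subset> residues g"
      using sub h by blast
    then have card: "card (residues u) < card (residues g)"
      by (rule psubset_card_mono[OF finite_residues])
    obtain m where m: "fls_nth h m \<noteq> 0"
      using False unfolding fls_nonzero_nth by blast
    \<comment> \<open>\<open>h\<close> has no exponent in the class of \<open>k\<close>, so its
      coefficient at \<open>m\<close> survives in \<open>u\<close>.\<close>
    then have "m \<noteq> k"
      using residuesI[OF m] h by blast
    then have "fls_nth u m \<noteq> 0"
      using m lam_nonzero by (simp add: nth q_powi_inj)
    then have "u \<noteq> 0"
      by auto
    then obtain S where "act S u = 1"
      using less.hyps[OF card] by blast
    then show ?thesis
      unfolding u act_mult[symmetric] ..
  qed
qed

text \<open>Once \<open>1\<close> is reached, \<open>P\<close> leads on to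
  \<open>act P 1\<close>.\<close>

lemma Dq_transitive:
  assumes "R \<notin> J"
  shows "\<exists>S. qop_mult q S R - P \<in> J"
proof -
  obtain S where "act S (act R 1) = 1"
    using act_to_one[of "act R 1"] assms by (auto simp: J_eq_annihilator)
  then have "qop_mult q (qop_mult q P S) R - P \<in> J"
    by (simp add: J_eq_annihilator act_diff_left act_mult)
  then show ?thesis ..
qed

section \<open>Elements of \<open>A\<close> in \<open>J\<close>\<close>

lemma K_minus_lam: "K - qmon lam 0 0 = qop_mult q (qmon 1 (int a) 0) Q"
  by (simp add: K_op_eq Q_op_eq q_nonzero qop_mult_diff_right qmon_mult)

lemma K_minus_lam_in_J: "K - qmon lam 0 0 \<in> J"
  unfolding K_minus_lam J_alt by blast

text \<open>As \<open>x^a\<close> is a unit of \<open>Dq q\<close>, \<open>Q\<close> and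
  \<open>K - lam\<close> generate the same left ideal there.\<close>

lemma Q_eq_mult_K_minus_lam: "Q = qop_mult q (qmon 1 (- int a) 0) (K - qmon lam 0 0)"
  by (simp add: K_minus_lam qmon_mult flip: qop_mult_assoc[OF q_nonzero])
    (simp add: qop_mult_one flip: generators_eq_qmon(2) del: single_one)

text \<open>\<open>K\<close> carries the coefficient at \<open>(j - b, n - a)\<close> to
  \<open>(j, n)\<close>; the factor comes from moving \<open>y^(j - b)\<close> past
  \<open>x^a\<close>.\<close>

lemma lookup_mult_K_minus_lam:
  "fls_nth (Poly_Mapping.lookup (qop_mult q S (K - qmon lam 0 0)) j) n
   = q powi (- (j - int b) * int a) * fls_nth (Poly_Mapping.lookup S (j - int b)) (n - int a)
     - lam * fls_nth (Poly_Mapping.lookup S j) n"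
proof (induction S rule: qop_induct)
  case (single i f)
  have w: "(q powi - i) powi int a = q powi (- i * int a)"
    by (simp only: power_int_mult)
  have "fls_nth (f * fls_monom d k) m = d * fls_nth f (m - k)" for d k m
    by (subst mult.commute) simp
  then show ?case
    by (auto simp: K_op_eq qop_mult_diff_right qmon_def qop_mult_single lookup_minus
        lookup_single when_def w[simplified] algebra_simps)
next
  case (add P R)
  then show ?case
    unfolding qop_mult_add_left lookup_add fls_plus_nth by (simp add: distrib_left)
qed simp

text \<open>
  Comparing coefficients in \<open>R = S (K - lam)\<close> expresses each coefficient of \<open>S\<close> through one of
  lower \<open>y\<close>-degree, so that \<open>S\<close> inherits from \<open>R\<close> that only nonnegative powers occur.
\<close>

lemma A_inter_J:
  assumes "R \<in> A" "R \<in> J"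
  shows "\<exists>S\<in>A. R = qop_mult q S (K - qmon lam 0 0)"
proof -
  obtain P where "R = qop_mult q P Q"
    using assms(2) unfolding J_alt by blast
  then obtain S where S: "R = qop_mult q S (K - qmon lam 0 0)"
    unfolding Q_eq_mult_K_minus_lam qop_mult_assoc[OF q_nonzero, symmetric] by blast
  have nth: "lam * fls_nth (Poly_Mapping.lookup S j) n
      = q powi (- (j - int b) * int a) * fls_nth (Poly_Mapping.lookup S (j - int b)) (n - int a)
        - fls_nth (Poly_Mapping.lookup R j) n" for j n
    unfolding S lookup_mult_K_minus_lam by simp
  have R: "finite {n. fls_nth (Poly_Mapping.lookup R j) n \<noteq> 0}"
      "n < 0 \<or> j < 0 \<Longrightarrow> fls_nth (Poly_Mapping.lookup R j) n = 0" for j n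
    using assms(1) by (auto simp: Aq_carrier q_nonzero)
  \<comment> \<open>A lower bound for the \<open>y\<close>-degrees of \<open>S\<close>, where the
    induction can start; the inserted \<open>0\<close> keeps the set nonempty.\<close>
  define N where "N = Min (insert 0 (Poly_Mapping.keys S))"
  have N: "Poly_Mapping.lookup S j = 0" if "j < N" for j
  proof (rule ccontr)
    assume "Poly_Mapping.lookup S j \<noteq> 0"
    then have "N \<le> j"
      unfolding N_def by (intro Min_le) (auto simp: in_keys_iff)
    with that show False
      by simp
  qed
  have "finite {n. fls_nth (Poly_Mapping.lookup S j) n \<noteq> 0} \<and>
      (\<forall>n. n < 0 \<or> j < 0 \<longrightarrow> fls_nth (Poly_Mapping.lookup S j) n = 0)" for j
  \<comment> \<open>The measure is 0 exactly for \<open>j < N\<close>, and for larger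
    \<open>j\<close> it drops strictly on passing to \<open>j - b\<close>.\<close>
  proof (induction "nat (j + 1 - N)" arbitrary: j rule: less_induct)
    case less
    show ?case
    proof (cases "j < N")
      case False
      then have IH: "finite {n. fls_nth (Poly_Mapping.lookup S (j - int b)) n \<noteq> 0}"
          "n < 0 \<or> j - int b < 0 \<Longrightarrow> fls_nth (Poly_Mapping.lookup S (j - int b)) n = 0" for n
        using less[of "j - int b"] b_pos by auto
      have "{n. fls_nth (Poly_Mapping.lookup S j) n \<noteq> 0}
          \<subseteq> (\<lambda>n. n + int a) ` {n. fls_nth (Poly_Mapping.lookup S (j - int b)) n \<noteq> 0}
            \<union> {n. fls_nth (Poly_Mapping.lookup R j) n \<noteq> 0}" (is "_ \<subseteq> ?B")
      proof
        fix n
        assume "n \<in> {n. fls_nth (Poly_Mapping.lookup S j) n \<noteq> 0}"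
        then have "fls_nth (Poly_Mapping.lookup S (j - int b)) (n - int a) \<noteq> 0
            \<or> fls_nth (Poly_Mapping.lookup R j) n \<noteq> 0"
          using nth[of j n] lam_nonzero by auto
        then show "n \<in> ?B"
          by (auto intro!: image_eqI[of _ _ "n - int a"])
      qed
      then have "finite {n. fls_nth (Poly_Mapping.lookup S j) n \<noteq> 0}"
        by (rule finite_subset) (use IH(1) R(1) in auto)
      moreover have "fls_nth (Poly_Mapping.lookup S j) n = 0" if "n < 0 \<or> j < 0" for n
        using nth[of j n] IH(2)[of "n - int a"] R(2)[OF that] that lam_nonzero by auto
      ultimately show ?thesis
        by blast
    qed (simp add: N)
  qed
  then have "S \<in> A"
    by (simp add: Aq_carrier q_nonzero)
  with S show ?thesis
    by blast
qed

end

section \<open>Quotient modules over subrings\<close>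

lemma qmon_one_mult: "qop_mult q (qmon 1 0 0) P = P" "qop_mult q P (qmon 1 0 0) = P"
  unfolding generators_eq_qmon(2)[symmetric] by (rule qop_mult_one)+

definition coset :: "qop set \<Rightarrow> qop \<Rightarrow> qop set" where
  "coset I P = (\<lambda>i. i + P) ` I"

text \<open>The quotient of \<open>R\<close> by \<open>I\<close> is restricted to the smaller ring \<open>S\<close>.\<close>

locale quotient_Dq =
  fixes q :: complex and R S I :: "qop set"
  assumes q_nz: "q \<noteq> 0" and R: "subring R (Dq q)" and S: "subring S (Dq q)"
    and S_subset: "S \<subseteq> R" and I_subset: "I \<subseteq> R" and zero_I: "0 \<in> I"
    and diff_I: "P \<in> I \<Longrightarrow> P' \<in> I \<Longrightarrow> P - P' \<in> I"
    and mult_I: "P \<in> R \<Longrightarrow> P' \<in> I \<Longrightarrow> qop_mult q P P' \<in> I"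
begin

abbreviation "M \<equiv> quotient_module (Dq q\<lparr>carrier := R\<rparr>) I"

lemma add_I: "P \<in> I \<Longrightarrow> P' \<in> I \<Longrightarrow> P + P' \<in> I"
  using diff_I[of P "0 - P'"] diff_I[OF zero_I, of P'] by simp

lemma mem_coset_iff: "P \<in> coset I P' \<longleftrightarrow> P - P' \<in> I"
  by (force simp: coset_def)

lemma coset_eq_iff: "coset I P = coset I P' \<longleftrightarrow> P - P' \<in> I"
proof
  assume "coset I P = coset I P'"
  then have "P \<in> coset I P'"
    using zero_I mem_coset_iff[of P P] by simp
  then show "P - P' \<in> I"
    by (simp add: mem_coset_iff)
next
  assume d: "P - P' \<in> I"
  show "coset I P = coset I P'"
  proof (rule Set.set_eqI)
    fix T
    have "T - P' \<in> I" if "T - P \<in> I"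
      using add_I[OF that d] by simp
    moreover have "T - P \<in> I" if "T - P' \<in> I"
      using diff_I[OF that d] by simp
    ultimately show "T \<in> coset I P \<longleftrightarrow> T \<in> coset I P'"
      unfolding mem_coset_iff by blast
  qed
qed

lemma a_r_coset_eq: "I +>\<^bsub>Dq q\<lparr>carrier := R\<rparr>\<^esub> P = coset I P"
  by (auto simp: a_r_coset_def r_coset_def coset_def)

lemma M_carrier: "carrier M = coset I ` R"
proof -
  have "coset I P = (\<Union>i\<in>I. {i + P})" for P
    by (auto simp: coset_def)
  then show ?thesis
    by (auto simp: quotient_module_def A_RCOSETS_def RCOSETS_def r_coset_def)
qed

lemma M_zero: "\<zero>\<^bsub>M\<^esub> = coset I 0"
  by (simp add: quotient_module_def coset_def)

lemma M_add: "coset I P \<oplus>\<^bsub>M\<^esub> coset I P' = coset I (P + P')"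
proof (rule Set.set_eqI)
  fix T
  have "T \<in> coset I P \<oplus>\<^bsub>M\<^esub> coset I P' \<longleftrightarrow> (\<exists>i\<in>I. \<exists>i'\<in>I. T = (i + P) + (i' + P'))"
    by (auto simp: quotient_module_def set_add_def set_mult_def coset_def)
  also have "\<dots> \<longleftrightarrow> T - (P + P') \<in> I"
  proof
    assume "T - (P + P') \<in> I"
    then show "\<exists>i\<in>I. \<exists>i'\<in>I. T = (i + P) + (i' + P')"
      using zero_I by (intro bexI[of _ "T - (P + P')"] bexI[of _ 0]) simp_all
  qed (auto intro!: add_I)
  finally show "T \<in> coset I P \<oplus>\<^bsub>M\<^esub> coset I P' \<longleftrightarrow> T \<in> coset I (P + P')"
    by (simp add: mem_coset_iff)
qed

text \<open>The union defining the scalar action runs over all representatives; it collapses to one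
  coset because \<open>I\<close> absorbs multiplication by \<open>R\<close> from the left.\<close>

lemma M_smult:
  assumes "T \<in> R"
  shows "T \<odot>\<^bsub>M\<^esub> coset I P = coset I (qop_mult q T P)"
proof -
  have "coset I (qop_mult q T P') = coset I (qop_mult q T P)" if "P' \<in> coset I P" for P'
    using mult_I[OF assms, of "P' - P"] that by (simp add: coset_eq_iff mem_coset_iff qop_mult_diff_right)
  moreover have "P \<in> coset I P"
    by (simp add: mem_coset_iff zero_I)
  ultimately have "(\<Union>P'\<in>coset I P. coset I (qop_mult q T P')) = coset I (qop_mult q T P)"
    by blast
  then show ?thesis
    by (simp add: quotient_module_def a_r_coset_eq)
qed

lemma left_module_M: "left_module (Dq q\<lparr>carrier := S\<rparr>) M"
proof -
  interpret D: ring "Dq q"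
    by (rule ring_Dq[OF q_nz])
  have ab: "abelian_group M"
  proof (rule abelian_groupI)
    show "\<zero>\<^bsub>M\<^esub> \<in> carrier M"
      using subring_zero[OF q_nz R] by (simp add: M_carrier M_zero)
  next
    fix x
    assume "x \<in> carrier M"
    then obtain P where P: "P \<in> R" "x = coset I P"
      by (auto simp: M_carrier)
    then show "\<exists>y\<in>carrier M. y \<oplus>\<^bsub>M\<^esub> x = \<zero>\<^bsub>M\<^esub>"
      using subring_uminus[OF q_nz R P(1)]
      by (intro bexI[of _ "coset I (- P)"]) (auto simp: M_add M_zero M_carrier)
  next
    fix x y
    assume "x \<in> carrier M" "y \<in> carrier M"
    then obtain P P' where P: "P \<in> R" "P' \<in> R" "x = coset I P" "y = coset I P'"
      by (auto simp: M_carrier)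
    then show "x \<oplus>\<^bsub>M\<^esub> y \<in> carrier M"
      by (simp add: M_add M_carrier subring_add[OF R])
    show "x \<oplus>\<^bsub>M\<^esub> y = y \<oplus>\<^bsub>M\<^esub> x"
      using P by (simp add: M_add add.commute)
    fix z
    assume "z \<in> carrier M"
    then obtain P'' where "z = coset I P''"
      by (auto simp: M_carrier)
    then show "x \<oplus>\<^bsub>M\<^esub> y \<oplus>\<^bsub>M\<^esub> z = x \<oplus>\<^bsub>M\<^esub> (y \<oplus>\<^bsub>M\<^esub> z)"
      using P by (simp add: M_add add.assoc)
  next
    fix x
    assume "x \<in> carrier M"
    then obtain P where "x = coset I P"
      by (auto simp: M_carrier)
    then show "\<zero>\<^bsub>M\<^esub> \<oplus>\<^bsub>M\<^esub> x = x"
      by (simp add: M_add M_zero)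
  qed
  have ring: "ring (Dq q\<lparr>carrier := S\<rparr>)"
    by (rule D.subring_is_ring[OF S])
  have closed: "T \<odot>\<^bsub>M\<^esub> x \<in> carrier M" if "T \<in> R" "x \<in> carrier M" for T x
    using that by (auto simp: M_carrier M_smult subring_mult[OF R])
  have SR: "T \<in> R" if "T \<in> S" for T
    using that S_subset by blast
  show ?thesis
  proof (intro left_module.intro left_module_axioms.intro ring ab)
    fix T T' x y
    assume TT': "T \<in> carrier (Dq q\<lparr>carrier := S\<rparr>)" "T' \<in> carrier (Dq q\<lparr>carrier := S\<rparr>)"
    assume "x \<in> carrier M" "y \<in> carrier M"
    then obtain P P' where x: "x = coset I P" and y: "y = coset I P'"
      by (auto simp: M_carrier)
    have T: "T \<in> R" "T' \<in> R" "T + T' \<in> R" "qop_mult q T T' \<in> R"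
      using TT' by (simp_all add: SR subring_add[OF R] subring_mult[OF R])
    show "(T \<oplus>\<^bsub>Dq q\<lparr>carrier := S\<rparr>\<^esub> T') \<odot>\<^bsub>M\<^esub> x = T \<odot>\<^bsub>M\<^esub> x \<oplus>\<^bsub>M\<^esub> T' \<odot>\<^bsub>M\<^esub> x"
      by (simp add: x M_smult M_add T qop_mult_add_left)
    show "T \<odot>\<^bsub>M\<^esub> (x \<oplus>\<^bsub>M\<^esub> y) = T \<odot>\<^bsub>M\<^esub> x \<oplus>\<^bsub>M\<^esub> T \<odot>\<^bsub>M\<^esub> y"
      by (simp add: x y M_smult M_add T qop_mult_add_right)
    show "(T \<otimes>\<^bsub>Dq q\<lparr>carrier := S\<rparr>\<^esub> T') \<odot>\<^bsub>M\<^esub> x = T \<odot>\<^bsub>M\<^esub> (T' \<odot>\<^bsub>M\<^esub> x)"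
      by (simp add: x M_smult T qop_mult_assoc[OF q_nz])
  next
    fix x
    assume "x \<in> carrier M"
    then obtain P where x: "x = coset I P"
      by (auto simp: M_carrier)
    show "\<one>\<^bsub>Dq q\<lparr>carrier := S\<rparr>\<^esub> \<odot>\<^bsub>M\<^esub> x = x"
      by (simp add: x M_smult subring_one[OF R] qmon_one_mult)
  qed (simp add: SR closed)
qed

text \<open>Scalars from \<open>S\<close> take any nonzero coset to every other, so a nonzero
  submodule is everything. The simplicity claims over \<open>Dq q\<close>, \<open>Lq q\<close> and
  \<open>Aq q\<close> are all instances.\<close>

lemma simple_left_module_M:
  assumes one: "qmon 1 0 0 \<notin> I"
    and trans: "\<And>T P. T \<in> R \<Longrightarrow> T \<notin> I \<Longrightarrow> P \<in> R \<Longrightarrow> \<exists>U\<in>S. qop_mult q U T - P \<in> I"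
  shows "simple_left_module (Dq q\<lparr>carrier := S\<rparr>) M"
  unfolding simple_left_module_def
proof (intro conjI allI impI left_module_M)
  have "coset I (qmon 1 0 0) \<noteq> coset I 0"
    using one by (simp add: coset_eq_iff)
  then show "carrier M \<noteq> {\<zero>\<^bsub>M\<^esub>}"
    using subring_one[OF R] by (auto simp: M_carrier M_zero)
next
  fix N
  assume N: "submodule N (Dq q\<lparr>carrier := S\<rparr>) M"
  then have zero: "\<zero>\<^bsub>M\<^esub> \<in> N" and sub: "N \<subseteq> carrier M"
    and closed: "\<And>U x. U \<in> S \<Longrightarrow> x \<in> N \<Longrightarrow> U \<odot>\<^bsub>M\<^esub> x \<in> N"
    using subgroup.one_closed[of N "add_monoid M"] subgroup.subset[of N "add_monoid M"]
    by (auto simp: submodule_def submodule_axioms_def)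
  show "N = {\<zero>\<^bsub>M\<^esub>} \<or> N = carrier M"
  proof (rule disjCI)
    assume "N \<noteq> carrier M"
    have "x = \<zero>\<^bsub>M\<^esub>" if x: "x \<in> N" for x
    proof (rule ccontr)
      assume "x \<noteq> \<zero>\<^bsub>M\<^esub>"
      moreover obtain T where T: "T \<in> R" "x = coset I T"
        using x sub by (auto simp: M_carrier)
      ultimately have "T \<notin> I"
        by (auto simp: M_zero coset_eq_iff)
      have "coset I P \<in> N" if P: "P \<in> R" for P
      proof -
        obtain U where U: "U \<in> S" "qop_mult q U T - P \<in> I"
          using trans[OF T(1) \<open>T \<notin> I\<close> P] by blast
        then have "U \<odot>\<^bsub>M\<^esub> x = coset I P"
          using S_subset by (simp add: T(2) M_smult subsetD coset_eq_iff)
        then show ?thesis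
          using closed[OF U(1) x] by simp
      qed
      then have "N = carrier M"
        using sub by (auto simp: M_carrier)
      with \<open>N \<noteq> carrier M\<close> show False ..
    qed
    then show "N = {\<zero>\<^bsub>M\<^esub>}"
      using zero by blast
  qed
qed

end

lemma Aq_simps [simp]:
  "mult (Aq q) = qop_mult q" "one (Aq q) = qmon 1 0 0" "add (Aq q) = (+)"
  by (simp_all add: Aq_def gen_subalgebra_def)

lemma Dq_eq_update: "Dq q = Dq q\<lparr>carrier := UNIV\<rparr>"
  by (simp add: Dq_def)

lemma Lq_eq_update: "Lq q = Dq q\<lparr>carrier := carrier (Lq q)\<rparr>"
  by (simp add: Lq_def gen_subalgebra_def)

lemma Aq_eq_update: "Aq q = Dq q\<lparr>carrier := carrier (Aq q)\<rparr>"
  by (simp add: Aq_def gen_subalgebra_def)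

lemma exists_complex_nth_root:
  fixes z :: complex
  assumes "n > 0"
  shows "\<exists>w. w ^ n = z"
proof
  show "rcis (root n (cmod z)) (Arg z / real n) ^ n = z"
    using assms by (simp add: DeMoivre2 rcis_cmod_Arg)
qed

section \<open>Eigenvectors of K\<close>

locale Aq_module = left_module "Aq q" M for q and M :: "(qop, 'b, 'm) module_scheme" (structure) +
  assumes q_nz: "q \<noteq> 0"
begin

lemma smult_closed [simp]:
  "T \<in> carrier (Aq q) \<Longrightarrow> x \<in> carrier M \<Longrightarrow> T \<odot> x \<in> carrier M"
  by (rule lsmult_closed)

lemma smult_assoc:
  "T \<in> carrier (Aq q) \<Longrightarrow> U \<in> carrier (Aq q) \<Longrightarrow> x \<in> carrier M \<Longrightarrow> qop_mult q T U \<odot> x = T \<odot> (U \<odot> x)"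
  using lsmult_assoc[of T U x] by simp

lemma smult_add_left:
  "T \<in> carrier (Aq q) \<Longrightarrow> U \<in> carrier (Aq q) \<Longrightarrow> x \<in> carrier M \<Longrightarrow> (T + U) \<odot> x = T \<odot> x \<oplus> U \<odot> x"
  using lsmult_l_distr[of T U x] by simp

lemma smult_one: "x \<in> carrier M \<Longrightarrow> qmon 1 0 0 \<odot> x = x"
  using lsmult_one[of x] by simp

lemma zero_in_Aq [simp]: "0 \<in> carrier (Aq q)"
  by (rule subring_zero[OF q_nz subring_Aq[OF q_nz]])

lemma smult_zero_left [simp]:
  assumes "x \<in> carrier M"
  shows "0 \<odot> x = \<zero>"
proof -
  have "0 \<odot> x \<oplus> 0 \<odot> x = 0 \<odot> x"
    using smult_add_left[of 0 0 x] assms by simp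
  then show ?thesis
    using assms M.add.l_cancel_one[of "0 \<odot> x" "0 \<odot> x"] by simp
qed

lemma smult_zero_right [simp]:
  assumes "T \<in> carrier (Aq q)"
  shows "T \<odot> \<zero> = \<zero>"
  using smult_assoc[OF assms zero_in_Aq, of \<zero>] by simp

lemma smult_eq_iff:
  assumes "T \<in> carrier (Aq q)" "U \<in> carrier (Aq q)" "x \<in> carrier M"
  shows "T \<odot> x = U \<odot> x \<longleftrightarrow> (T - U) \<odot> x = \<zero>"
proof -
  have "T - U \<in> carrier (Aq q)"
    by (rule subring_diff[OF q_nz subring_Aq[OF q_nz] assms(1,2)])
  then have "T \<odot> x = (T - U) \<odot> x \<oplus> U \<odot> x" "(T - U) \<odot> x \<in> carrier M" "U \<odot> x \<in> carrier M"
    using smult_add_left[of "T - U" U x] assms by simp_all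
  then show ?thesis
    by (metis M.add.r_cancel_one M.l_zero)
qed

lemma submodule_cyclic:
  assumes w: "w \<in> carrier M"
  shows "submodule {T \<odot> w |T. T \<in> carrier (Aq q)} (Aq q) M"
proof (intro submodule.intro submodule_axioms.intro M.add.subgroupI)
  note A = subring_Aq[OF q_nz]
  show "{T \<odot> w |T. T \<in> carrier (Aq q)} \<subseteq> carrier M"
    using w by auto
  show "{T \<odot> w |T. T \<in> carrier (Aq q)} \<noteq> {}"
    using zero_in_Aq by blast
  fix x
  assume "x \<in> {T \<odot> w |T. T \<in> carrier (Aq q)}"
  then obtain T where T: "T \<in> carrier (Aq q)" "x = T \<odot> w"
    by blast
  have T': "- T \<in> carrier (Aq q)"
    by (rule subring_uminus[OF q_nz A T(1)])
  have "(- T) \<odot> w \<oplus> T \<odot> w = \<zero>"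
    using smult_add_left[OF T' T(1) w] w by simp
  then have "\<ominus> x = (- T) \<odot> w"
    using T T' w by (simp add: M.minus_equality)
  then show "\<ominus> x \<in> {T \<odot> w |T. T \<in> carrier (Aq q)}"
    using T' by blast
  fix y
  assume "y \<in> {T \<odot> w |T. T \<in> carrier (Aq q)}"
  then obtain U where U: "U \<in> carrier (Aq q)" "y = U \<odot> w"
    by blast
  then have "x \<oplus> y = (T + U) \<odot> w"
    using T w by (simp add: smult_add_left)
  then show "x \<oplus> y \<in> {T \<odot> w |T. T \<in> carrier (Aq q)}"
    using subring_add[OF A T(1) U(1)] by blast
next
  fix U x
  assume U: "U \<in> carrier (Aq q)" and "x \<in> {T \<odot> w |T. T \<in> carrier (Aq q)}"
  then obtain T where T: "T \<in> carrier (Aq q)" "x = T \<odot> w"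
    by blast
  then have "U \<odot> x = qop_mult q U T \<odot> w"
    using smult_assoc[OF U T(1) w] by simp
  then show "U \<odot> x \<in> {T \<odot> w |T. T \<in> carrier (Aq q)}"
    using subring_mult[OF subring_Aq[OF q_nz] U T(1)] by blast
qed

lemma simple_cyclic:
  assumes "simple_left_module (Aq q) M" "w \<in> carrier M" "w \<noteq> \<zero>"
  shows "carrier M = {T \<odot> w |T. T \<in> carrier (Aq q)}"
proof -
  have "w \<in> {T \<odot> w |T. T \<in> carrier (Aq q)}"
    using smult_one[OF assms(2)] Aq_generators(1)[of 1 q] by force
  then show ?thesis
    using assms(1,3) submodule_cyclic[OF assms(2)] unfolding simple_left_module_def by blast
qed

text \<open>\<open>x^(a N) y^(b N)\<close> is \<open>K^N\<close> up to a power of \<open>q\<close>,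
  hence acts on \<open>v\<close> by a nonzero scalar.\<close>

lemma eigenvector_power:
  assumes v: "v \<in> carrier M" and \<mu>: "\<mu> \<noteq> 0" and K: "K_op q a b \<odot> v = qmon \<mu> 0 0 \<odot> v"
  shows "\<exists>\<kappa>. \<kappa> \<noteq> 0 \<and> qmon 1 (int (a * N)) (int (b * N)) \<odot> v = qmon \<kappa> 0 0 \<odot> v"
proof (induction N)
  case 0
  show ?case
    by (intro exI[of _ 1]) simp
next
  case (Suc N)
  then obtain \<kappa> where \<kappa>: "\<kappa> \<noteq> 0" "qmon 1 (int (a * N)) (int (b * N)) \<odot> v = qmon \<kappa> 0 0 \<odot> v"
    by blast
  \<comment> \<open>Compensates the factor that arises from moving \<open>y^(b N)\<close> past
    \<open>x^a\<close>.\<close>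
  define d where "d = q powi (int (b * N) * int a)"
  let ?X = "qmon d (int (a * N)) (int (b * N))"
  have A: "qmon c (int n) (int j) \<in> carrier (Aq q)" "qmon c 0 0 \<in> carrier (Aq q)" for c n j
    by (simp_all add: qmon_in_Aq q_nz)
  have "d * q powi (- (int (b * N) * int a)) = 1"
    using q_nz by (simp add: d_def flip: power_int_add)
  then have "qmon 1 (int (a * Suc N)) (int (b * Suc N)) = qop_mult q ?X (qmon 1 (int a) (int b))"
    by (simp add: qmon_mult algebra_simps)
  then have "qmon 1 (int (a * Suc N)) (int (b * Suc N)) \<odot> v = ?X \<odot> (qmon \<mu> 0 0 \<odot> v)"
    using K by (simp only: smult_assoc A v K_op_eq)
  also have "\<dots> = qop_mult q (qmon (d * \<mu>) 0 0) (qmon 1 (int (a * N)) (int (b * N))) \<odot> v"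
    using smult_assoc[OF A(1) A(2) v, of d "a * N" "b * N" \<mu>] by (simp add: qmon_mult)
  also have "\<dots> = qmon (d * \<mu>) 0 0 \<odot> (qmon \<kappa> 0 0 \<odot> v)"
    using \<kappa>(2) by (simp only: smult_assoc A v)
  also have "\<dots> = qmon (d * \<mu> * \<kappa>) 0 0 \<odot> v"
    using smult_assoc[OF A(2) A(2) v, of "d * \<mu>" \<kappa>] by (simp add: qmon_mult)
  finally have "qmon 1 (int (a * Suc N)) (int (b * Suc N)) \<odot> v = qmon (d * \<mu> * \<kappa>) 0 0 \<odot> v" .
  moreover have "d * \<mu> * \<kappa> \<noteq> 0"
    using \<kappa>(1) \<mu> q_nz by (simp add: d_def)
  ultimately show ?case
    by blast
qed

text \<open>Some multiple of \<open>x\<^sup>n y\<^sup>j\<close> is a power of \<open>K\<close> up to a scalar, so \<open>x\<^sup>n y\<^sup>j\<close> cannot annihilate \<open>v\<close>.\<close>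

lemma qmon_smult_eigenvector_nonzero:
  assumes v: "v \<in> carrier M" "v \<noteq> \<zero>" and \<mu>: "\<mu> \<noteq> 0" and ab: "a > 0" "b > 0"
    and K: "K_op q a b \<odot> v = qmon \<mu> 0 0 \<odot> v"
  shows "qmon 1 (int n) (int j) \<odot> v \<noteq> \<zero>"
proof
  assume zero: "qmon 1 (int n) (int j) \<odot> v = \<zero>"
  \<comment> \<open>Since \<open>a\<close> and \<open>b\<close> are positive, \<open>a N\<close>
    bounds \<open>n\<close> and \<open>b N\<close> bounds \<open>j\<close>, so the complementary
    monomial \<open>?Y\<close> has nonnegative exponents.\<close>
  define N where "N = n + j"
  have le: "n \<le> a * N" "j \<le> b * N"
    using ab by (auto simp: N_def intro: order_trans[of _ "n + j"])
  define d where "d = q powi ((int (b * N) - int j) * int n)"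
  have A: "qmon c (int n) (int j) \<in> carrier (Aq q)" "qmon c 0 0 \<in> carrier (Aq q)" for c n j
    by (simp_all add: qmon_in_Aq q_nz)
  have Y: "qmon d (int (a * N) - int n) (int (b * N) - int j) \<in> carrier (Aq q)" (is "?Y \<in> _")
    using le by (intro qmon_in_Aq q_nz) linarith+
  have "d * 1 * q powi - ((int (b * N) - int j) * int n) = 1"
    using q_nz by (simp add: d_def power_int_minus)
  then have "qop_mult q ?Y (qmon 1 (int n) (int j)) = qmon 1 (int (a * N)) (int (b * N))"
    by (simp only: qmon_mult mult_minus_left) simp
  moreover obtain \<kappa> where \<kappa>: "\<kappa> \<noteq> 0"
      "qmon 1 (int (a * N)) (int (b * N)) \<odot> v = qmon \<kappa> 0 0 \<odot> v"
    using eigenvector_power[OF v(1) \<mu> K] by blast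
  ultimately have "qmon \<kappa> 0 0 \<odot> v = ?Y \<odot> (qmon 1 (int n) (int j) \<odot> v)"
    using smult_assoc[OF Y A(1) v(1), of 1 n j] by simp
  then have "qmon \<kappa> 0 0 \<odot> v = \<zero>"
    using zero Y by simp
  moreover have "v = qmon (1 / \<kappa>) 0 0 \<odot> (qmon \<kappa> 0 0 \<odot> v)"
    using smult_assoc[OF A(2) A(2) v(1), of "1 / \<kappa>" \<kappa>] \<kappa>(1) by (simp add: qmon_mult smult_one v(1))
  ultimately show False
    using v(2) A(2) by simp
qed

end

context q_weights
begin

section \<open>The modules attached to Q\<close>

lemma mult_J: "P' \<in> J \<Longrightarrow> qop_mult q P P' \<in> J"
  by (simp add: J_eq_annihilator act_mult)

lemma one_notin_J: "qmon 1 0 0 \<notin> J"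
  by (simp add: J_eq_annihilator)

sublocale D_quotient: quotient_Dq q UNIV UNIV J
proof (rule quotient_Dq.intro)
  interpret D: ring "Dq q"
    by (rule ring_Dq[OF q_nonzero])
  show "subring UNIV (Dq q)"
    using D.carrier_is_subring by simp
  then show "subring UNIV (Dq q)" .
qed (simp_all add: q_nonzero zero_in_J J_diff mult_J)

text \<open>Serves both \<open>S = L\<close> and \<open>S = A\<close>: restriction keeps the module
  and changes only the scalars.\<close>

lemma quotient_L:
  assumes S: "subring S (Dq q)" "S \<subseteq> L"
  shows "quotient_Dq q L S (L \<inter> J)"
proof (rule quotient_Dq.intro)
  note L = subring_Lq[OF q_nonzero]
  show "subring L (Dq q)" by (rule L)
  show "0 \<in> L \<inter> J"
    using zero_in_J subring_zero[OF q_nonzero L] by blast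
  show "P - P' \<in> L \<inter> J" if "P \<in> L \<inter> J" "P' \<in> L \<inter> J" for P P'
    using that J_diff subring_diff[OF q_nonzero L] by blast
  show "qop_mult q P P' \<in> L \<inter> J" if "P \<in> L" "P' \<in> L \<inter> J" for P P'
    using that mult_J subring_mult[OF L] by blast
qed (use S q_nonzero in simp_all)

sublocale LL: quotient_Dq q L L "L \<inter> J"
  by (rule quotient_L[OF subring_Lq[OF q_nonzero]]) simp

sublocale LA: quotient_Dq q L A "L \<inter> J"
  by (rule quotient_L[OF subring_Aq[OF q_nonzero] Aq_subset_Lq])

lemma L_Q_eq: "L_Q q a b lam = LA.M"
  unfolding L_Q_def by (subst Lq_eq_update) simp

lemma L_transitive':
  assumes "T \<in> L" "T \<notin> L \<inter> J" "P \<in> L"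
  shows "\<exists>U\<in>A. qop_mult q U T - P \<in> L \<inter> J"
proof -
  obtain U where U: "U \<in> A" "qop_mult q U T - P \<in> J"
    using L_transitive[of T P] assms by blast
  have "qop_mult q U T - P \<in> L"
    using U(1) assms(1,3) Aq_subset_Lq[of q]
    by (intro subring_diff[OF q_nonzero] subring_mult subring_Lq q_nonzero) auto
  with U show ?thesis
    by blast
qed

text \<open>Transitivity starting from \<open>1\<close> shows that \<open>A\<close> represents every
  coset, so a map to an \<open>A\<close>-module can be defined on the quotient of
  \<open>L\<close>.\<close>

lemma coset_in_A:
  assumes "P \<in> L"
  shows "\<exists>U\<in>A. coset (L \<inter> J) P = coset (L \<inter> J) U"
proof -
  obtain U where "U \<in> A" "qop_mult q U (qmon 1 0 0) - P \<in> L \<inter> J"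
    using L_transitive'[of "qmon 1 0 0" P] assms one_notin_J subring_one[OF subring_Lq[OF q_nonzero]]
    by blast
  then have "U \<in> A" "coset (L \<inter> J) U = coset (L \<inter> J) P"
    by (simp_all only: LA.coset_eq_iff qmon_one_mult)
  then show ?thesis
    by metis
qed

lemma L_Q_carrier: "carrier (L_Q q a b lam) = coset (L \<inter> J) ` A"
proof
  show "carrier (L_Q q a b lam) \<subseteq> coset (L \<inter> J) ` A"
    unfolding L_Q_eq LA.M_carrier using coset_in_A by (metis image_eqI image_subsetI)
  show "coset (L \<inter> J) ` A \<subseteq> carrier (L_Q q a b lam)"
    unfolding L_Q_eq LA.M_carrier by (rule image_mono[OF Aq_subset_Lq])
qed

lemma simple_Lhat_Q: "simple_left_module (Dq q) (Lhat_Q q a b lam)"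
proof -
  have "simple_left_module (Dq q\<lparr>carrier := UNIV\<rparr>) D_quotient.M"
    using Dq_transitive by (intro D_quotient.simple_left_module_M one_notin_J) auto
  then show ?thesis
    unfolding Lhat_Q_def Dq_eq_update[symmetric] .
qed

lemma simple_L_Q: "simple_left_module (Lq q) (L_Q q a b lam)"
proof -
  have "simple_left_module (Dq q\<lparr>carrier := L\<rparr>) LL.M"
    using L_transitive' Aq_subset_Lq[of q] one_notin_J by (intro LL.simple_left_module_M) blast+
  then show ?thesis
    unfolding L_Q_eq Lq_eq_update[symmetric] .
qed

lemma simple_L_Q_over_A: "simple_left_module (Aq q) (L_Q q a b lam)"
proof -
  have "simple_left_module (Dq q\<lparr>carrier := A\<rparr>) LA.M"
    using L_transitive' one_notin_J by (intro LA.simple_left_module_M) blast+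
  then show ?thesis
    unfolding L_Q_eq Aq_eq_update[symmetric] .
qed

lemma is_L_ab_L_Q: "is_L_ab q a b lam (L_Q q a b lam)"
  unfolding is_L_ab_def
proof (intro conjI simple_L_Q_over_A bexI)
  let ?v = "coset (L \<inter> J) (qmon 1 0 0)"
  have one: "qmon 1 0 0 \<in> L"
    by (rule subring_one[OF subring_Lq[OF q_nonzero]])
  have L: "qmon d 0 0 \<in> L" "K \<in> L" for d
    using qmon_in_Aq[OF q_nonzero] Aq_subset_Lq[of q] by (auto simp: K_op_eq)
  show "?v \<in> carrier (L_Q q a b lam)"
    unfolding L_Q_eq LA.M_carrier using one by blast
  show "?v \<noteq> \<zero>\<^bsub>L_Q q a b lam\<^esub>"
    using one_notin_J by (simp add: L_Q_eq LA.M_zero LA.coset_eq_iff)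
  have "K - qmon lam 0 0 \<in> L \<inter> J"
    using K_minus_lam_in_J L subring_diff[OF q_nonzero subring_Lq[OF q_nonzero]] by blast
  then show "K \<odot>\<^bsub>L_Q q a b lam\<^esub> ?v = scalar_op lam \<odot>\<^bsub>L_Q q a b lam\<^esub> ?v"
    by (simp only: L_Q_eq generators_eq_qmon LA.M_smult L qmon_one_mult LA.coset_eq_iff)
  have "T \<odot>\<^bsub>L_Q q a b lam\<^esub> ?v = coset (L \<inter> J) T" if "T \<in> A" for T
    using that Aq_subset_Lq[of q] by (simp add: L_Q_eq LA.M_smult subsetD qmon_one_mult)
  then show "carrier (L_Q q a b lam) = {T \<odot>\<^bsub>L_Q q a b lam\<^esub> ?v |T. T \<in> A}"
    unfolding L_Q_carrier by force
qed

text \<open>In \<open>A\<close>, the vector \<open>w\<close> and the coset of \<open>1\<close> have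
  the same annihilator, so the coset of \<open>T\<close> can be sent to \<open>T w\<close>. The map
  is onto since simplicity makes \<open>w\<close> a generator.\<close>

lemma isomorphic_of_eigenvector:
  fixes M :: "(qop, 'c, 'm) module_scheme" (structure)
  assumes simple: "simple_left_module (Aq q) M" and w: "w \<in> carrier M" "w \<noteq> \<zero>"
    and K: "(K - qmon lam 0 0) \<odot> w = \<zero>"
  shows "left_module_isomorphic (Aq q) (L_Q q a b lam) M"
proof -
  interpret Aq_module q M
    using simple by (auto simp: Aq_module_def Aq_module_axioms_def simple_left_module_def q_nonzero)
  have K_A: "K - qmon lam 0 0 \<in> A"
    unfolding K_op_eq by (intro subring_diff[OF q_nonzero] subring_Aq qmon_in_Aq q_nonzero) auto
  have kernel: "T \<odot> w = \<zero> \<longleftrightarrow> T \<in> J" if T: "T \<in> A" for T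
  proof
    assume "T \<in> J"
    then obtain S where "S \<in> A" "T = qop_mult q S (K - qmon lam 0 0)"
      using A_inter_J T by blast
    then show "T \<odot> w = \<zero>"
      using smult_assoc[OF _ K_A w(1)] K by simp
  next
    assume zero: "T \<odot> w = \<zero>"
    show "T \<in> J"
    proof (rule ccontr)
      assume "T \<notin> J"
      \<comment> \<open>Outside \<open>J\<close>, \<open>T\<close> has a left inverse
        \<open>U\<close> modulo \<open>J\<close>; then \<open>U T w = w\<close> is nonzero, against
        \<open>T w = 0\<close>.\<close>
      then obtain U where U: "U \<in> A" "qop_mult q U T - qmon 1 0 0 \<in> J"
        using L_transitive[of T "qmon 1 0 0"] T Aq_subset_Lq[of q]
          subring_one[OF subring_Lq[OF q_nonzero]] by blast
      have one: "qmon 1 0 0 \<in> A" and UT: "qop_mult q U T \<in> A"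
        using subring_one subring_mult U(1) T subring_Aq[OF q_nonzero] by blast+
      then have "qop_mult q U T - qmon 1 0 0 \<in> A"
        by (intro subring_diff[OF q_nonzero] subring_Aq q_nonzero)
      then obtain S where "S \<in> A" "qop_mult q U T - qmon 1 0 0 = qop_mult q S (K - qmon lam 0 0)"
        using A_inter_J U(2) by blast
      then have "(qop_mult q U T - qmon 1 0 0) \<odot> w = \<zero>"
        using smult_assoc[OF _ K_A w(1)] K by simp
      then have "qop_mult q U T \<odot> w = w"
        using smult_eq_iff[OF UT one w(1)] smult_one[OF w(1)] by simp
      then show False
        using smult_assoc[OF U(1) T w(1)] zero U(1) w(2) by simp
    qed
  qed
  have A_L: "T \<in> L" if "T \<in> A" for T
    using that Aq_subset_Lq by blast
  have eq_iff: "coset (L \<inter> J) T = coset (L \<inter> J) U \<longleftrightarrow> T \<odot> w = U \<odot> w" if "T \<in> A" "U \<in> A" for T U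
  proof -
    have "T - U \<in> A"
      by (rule subring_diff[OF q_nonzero subring_Aq[OF q_nonzero] that])
    then show ?thesis
      using smult_eq_iff[OF that w(1)] kernel A_L by (simp add: LA.coset_eq_iff)
  qed
  \<comment> \<open>Some representative in \<open>A\<close> is chosen; by \<open>eq_iff\<close> the
    value does not depend on the choice.\<close>
  define h where "h C = (SOME T. T \<in> A \<and> C = coset (L \<inter> J) T) \<odot> w" for C
  have h: "h (coset (L \<inter> J) T) = T \<odot> w" if T: "T \<in> A" for T
  proof -
    define U where "U = (SOME U. U \<in> A \<and> coset (L \<inter> J) T = coset (L \<inter> J) U)"
    have "U \<in> A \<and> coset (L \<inter> J) T = coset (L \<inter> J) U"
      unfolding U_def by (rule someI[of _ T]) (use T in simp)
    then have "T \<odot> w = U \<odot> w"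
      using eq_iff[OF T, of U] by blast
    then show ?thesis
      unfolding h_def U_def by (rule sym)
  qed
  show ?thesis
    unfolding left_module_isomorphic_def
  proof (intro exI[of _ h] conjI ballI)
    have "inj_on h (carrier (L_Q q a b lam))"
    proof (rule inj_onI)
      fix x y
      assume "x \<in> carrier (L_Q q a b lam)" "y \<in> carrier (L_Q q a b lam)" and eq: "h x = h y"
      then obtain T U where "T \<in> A" "x = coset (L \<inter> J) T" "U \<in> A" "y = coset (L \<inter> J) U"
        unfolding L_Q_carrier by blast
      then show "x = y"
        using eq by (simp only: h eq_iff)
    qed
    moreover have "h ` carrier (L_Q q a b lam) = carrier M"
      unfolding L_Q_carrier simple_cyclic[OF simple w] by (force simp: h image_image)
    ultimately show "bij_betw h (carrier (L_Q q a b lam)) (carrier M)"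
      by (rule bij_betw_imageI)
  next
    fix x y
    assume "x \<in> carrier (L_Q q a b lam)" "y \<in> carrier (L_Q q a b lam)"
    then obtain T U where T: "T \<in> A" "x = coset (L \<inter> J) T" and U: "U \<in> A" "y = coset (L \<inter> J) U"
      unfolding L_Q_carrier by blast
    have "T + U \<in> A"
      by (rule subring_add[OF subring_Aq[OF q_nonzero] T(1) U(1)])
    then show "h (x \<oplus>\<^bsub>L_Q q a b lam\<^esub> y) = h x \<oplus> h y"
      using T U w by (simp add: L_Q_eq LA.M_add h smult_add_left)
  next
    fix r x
    assume r: "r \<in> A" and "x \<in> carrier (L_Q q a b lam)"
    then obtain T where T: "T \<in> A" "x = coset (L \<inter> J) T"
      unfolding L_Q_carrier by blast
    have "qop_mult q r T \<in> A"
      by (rule subring_mult[OF subring_Aq[OF q_nonzero] r T(1)])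
    then show "h (r \<odot>\<^bsub>L_Q q a b lam\<^esub> x) = r \<odot> h x"
      using T r w by (simp add: L_Q_eq LA.M_smult A_L h smult_assoc)
  qed
qed

lemma isomorphic_of_is_L_ab:
  fixes M :: "(qop, 'c, 'm) module_scheme" (structure)
  assumes \<mu>: "\<mu> \<in> qclass q lam" and M: "is_L_ab q a b \<mu> M"
  shows "left_module_isomorphic (Aq q) (L_Q q a b lam) M"
proof -
  have simple: "simple_left_module (Aq q) M"
    using M by (simp add: is_L_ab_def)
  interpret Aq_module q M
    using simple by (auto simp: Aq_module_def Aq_module_axioms_def simple_left_module_def q_nonzero)
  obtain v where v: "v \<in> carrier M" "v \<noteq> \<zero>" "K \<odot> v = qmon \<mu> 0 0 \<odot> v"
    using M by (auto simp: is_L_ab_def generators_eq_qmon)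
  obtain m where m: "\<mu> = q powi m * lam"
    using \<mu> by (auto simp: qclass_def)
  obtain n j where nj: "int b * int n - int a * int j = m"
    using exists_nat_combination[OF coprime a_pos b_pos] by blast
  have A: "qmon c (int n) (int j) \<in> A" "qmon c 0 0 \<in> A" "K \<in> A" for c n j
    by (simp_all add: qmon_in_Aq q_nonzero K_op_eq)
  have diff_A: "K - qmon c 0 0 \<in> A" for c
    by (intro subring_diff[OF q_nonzero] subring_Aq A q_nonzero)
  let ?w = "qmon 1 (int n) (int j) \<odot> v"
  have "q powi (- int b * int n) = q powi (- m) * q powi (- int j * int a)"
    using nj q_nonzero by (simp flip: power_int_add) (simp add: algebra_simps)
  moreover have "q powi (- m) * \<mu> = lam"
    using q_nonzero by (simp add: m power_int_minus)
  \<comment> \<open>\<open>K x^n y^j = q^(- m) x^n y^j K\<close>, because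
    \<open>b n - a j = m\<close>; this turns the eigenvalue \<open>q^m lam\<close> into
    \<open>lam\<close>.\<close>
  ultimately have comm: "qop_mult q (K - qmon lam 0 0) (qmon 1 (int n) (int j))
      = qop_mult q (qmon (q powi (- m)) (int n) (int j)) (K - qmon \<mu> 0 0)"
    by (simp add: K_op_eq qop_mult_diff_left qop_mult_diff_right qmon_mult add.commute)
  have "(K - qmon lam 0 0) \<odot> ?w
      = qmon (q powi (- m)) (int n) (int j) \<odot> ((K - qmon \<mu> 0 0) \<odot> v)"
    using smult_assoc[OF diff_A[of lam] A(1)[of 1 n j] v(1)]
      smult_assoc[OF A(1)[of "q powi (- m)" n j] diff_A[of \<mu>] v(1)] comm by simp
  moreover have "(K - qmon \<mu> 0 0) \<odot> v = \<zero>"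
    using v smult_eq_iff[OF A(3) A(2) v(1)] by simp
  ultimately have "(K - qmon lam 0 0) \<odot> ?w = \<zero>"
    using A(1) by simp
  moreover have "?w \<noteq> \<zero>"
    using qmon_smult_eigenvector_nonzero[OF v(1,2) _ a_pos b_pos v(3)] lam_nonzero q_nonzero
    by (simp add: m)
  ultimately show ?thesis
    using A(1) v(1) by (intro isomorphic_of_eigenvector[OF simple, of ?w]) simp_all
qed

end

theorem theorem6p2:
  fixes q lam :: complex and a b :: nat
  assumes "q \<noteq> 0" and "\<forall>n::nat. n > 0 \<longrightarrow> q ^ n \<noteq> 1"
    and "a > 0" and "b > 0" and "coprime a b" and "lam \<noteq> 0"
  shows "simple_left_module (Dq q) (Lhat_Q q a b lam)
    \<and> simple_left_module (Lq q) (L_Q q a b lam)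
    \<and> is_L_ab q a b lam (L_Q q a b lam)
    \<and> (\<forall>\<mu>\<in>qclass q lam. \<forall>M :: (qop, 'm) module.
          is_L_ab q a b \<mu> M \<longrightarrow> left_module_isomorphic (Aq q) (L_Q q a b lam) M)"
proof -
  \<comment> \<open>Complex roots exist; any \<open>s\<close> and \<open>c\<close> solving the two
    equations give an action on series in \<open>t\<close>.\<close>
  obtain s where "s ^ (2 * b) = q"
    using exists_complex_nth_root[of "2 * b" q] \<open>b > 0\<close> by auto
  moreover obtain c where "c ^ b = lam * s powi (- int (a * b * b))"
    using exists_complex_nth_root \<open>b > 0\<close> by blast
  ultimately interpret q_weights q lam s c a b
    using assms by unfold_locales auto
  show ?thesis
    using simple_Lhat_Q simple_L_Q is_L_ab_L_Q isomorphic_of_is_L_ab by blast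
qed

end
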